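(* Let $A \in \mathbb{Z}^{n\times n}$ and let $p$ be a prime. If $A$ is $p$-characterized, then $A$ is $p$-correspondent.
   Context: Let $p$ be a prime. $v_p$ denotes the $p$-adic valuation on $\mathbb{Q}_p\supseteq\mathbb{Q}$ (with $v_p(0)=\infty$), extended to any finite-degree extension $K_p$ of $\mathbb{Q}_p$ as follows: if $a\in K_p$ has minimal polynomial $x^{d}+a_{d-1}x^{d-1}+\cdots+a_0$ over $\mathbb{Q}_p$, then $v_p(a)=\frac1d v_p(a_0)$ (so values are rational, or $\infty$). Let $A\in\mathbb{Z}^{n\times n}$ have rank $r$. Its Smith normal form over $\mathbb{Z}$ is $\operatorname{diag}(s_1,\ldots,s_r,0,\ldots,0)$ with nonzero invariant factors $s_1\mid s_2\mid\cdots\mid s_r$. The $i$th determinantal divisor $\Delta_i$ is the GCD of all $i\times i$ minors of $A$; for $1\le i\le r$, $\Delta_i=s_1\cdots s_i$ (up to sign). Write the characteristic polynomial of $A$ as $\det(xI-A)=x^n+f_1x^{n-1}+\cdots+f_r x^{n-r}$ (coefficients $f_i$ with $i>r$ vanish). $A$ is called $p$-characterized if $v_p(f_i)=v_p(\Delta_i)$ for all $i\in\{1,\ldots,r\}$. $A$ is called $p$-correspondent if $A$ has exactly $r$ non-zero eigenvalues (counted with algebraic multiplicity) $\lambda_1,\ldots,\lambda_r$ in a finite-degree extension $K_p$ of $\mathbb{Q}_p$ and, when they are ordered so that $v_p(\lambda_1)\le\cdots\le v_p(\lambda_r)$, one has $v_p(s_i)=v_p(\lambda_i)$ for all $i\in\{1,\ldots,r\}$.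 *)

theory Defs
  imports
    "HOL-Algebra.Algebraic_Closure_Type"
    "HOL-Algebra.Embedded_Algebras"
    "HOL-Computational_Algebra.Fraction_Field"
    "HOL-Library.Extended_Real"
    "Jordan_Normal_Form.Char_Poly"
    "Jordan_Normal_Form.DL_Rank"
    "Jordan_Normal_Form.DL_Submatrix"
    "Berlekamp_Zassenhaus.Finite_Field"
begin

section \<open>The field of p-adic numbers\<close>

text \<open>
  The prime \<open>p\<close> is the cardinality of a type \<open>'p\<close> of class \<open>prime_card\<close>, as for the prime
  fields \<open>'p mod_ring\<close>.  The ring of \<open>p\<close>-adic integers is the inverse limit of the rings
  \<open>\<int> / p^n\<close>, whose elements are represented by their residues in \<open>{0..<p^n}\<close>.  Both this range
  restriction and compatibility are expressed by the single equation below.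
\<close>

typedef (overloaded) ('p :: prime_card) padic_int =
  "{x :: nat \<Rightarrow> int. \<forall>n. x n = x (Suc n) mod int CARD('p) ^ n}"
  morphisms residue Abs_padic_int
  by (rule exI[of _ "\<lambda>_. 0"]) simp

lemma prime_CARD: "prime (int CARD('p :: prime_card))"
  by (simp add: prime_card)

lemma CARD_gt_1: "int CARD('p :: prime_card) > 1"
  using prime_CARD prime_gt_1_int by blast

lemma mod_power_Suc_mod: "(a mod (p :: int) ^ Suc n) mod p ^ n = a mod p ^ n"
  by (simp add: mod_mod_cancel)

lemma residue_Suc: "residue (x :: 'p padic_int) (Suc n) mod int CARD('p :: prime_card) ^ n = residue x n"
  using residue[of x] by (metis (mono_tags, lifting) mem_Collect_eq)

lemma residue_mod [simp]:
  "residue (x :: 'p padic_int) n mod int CARD('p :: prime_card) ^ n = residue x n"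
  using residue_Suc[of x n] by (metis mod_mod_trivial)

lemma residue_Abs:
  assumes "\<And>n. x n = x (Suc n) mod int CARD('p) ^ n"
  shows "residue (Abs_padic_int x :: 'p :: prime_card padic_int) n = x n"
proof -
  have "x \<in> {x. \<forall>n. x n = x (Suc n) mod int CARD('p) ^ n}" using assms by blast
  thus ?thesis by (simp only: Abs_padic_int_inverse)
qed

lemma padic_int_eqI: "(\<And>n. residue x n = residue y n) \<Longrightarrow> x = y"
  by (metis residue_inject ext)

instantiation padic_int :: (prime_card) comm_ring_1
begin

definition "(0 :: 'a padic_int) = Abs_padic_int (\<lambda>_. 0)"
definition "(1 :: 'a padic_int) = Abs_padic_int (\<lambda>n. 1 mod int CARD('a) ^ n)"
definition "(x :: 'a padic_int) + y = Abs_padic_int (\<lambda>n. (residue x n + residue y n) mod int CARD('a) ^ n)"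
definition "- (x :: 'a padic_int) = Abs_padic_int (\<lambda>n. (- residue x n) mod int CARD('a) ^ n)"
definition "(x :: 'a padic_int) - y = Abs_padic_int (\<lambda>n. (residue x n - residue y n) mod int CARD('a) ^ n)"
definition "(x :: 'a padic_int) * y = Abs_padic_int (\<lambda>n. (residue x n * residue y n) mod int CARD('a) ^ n)"

lemma residue_0: "residue (0 :: 'a padic_int) n = 0"
  unfolding zero_padic_int_def by (subst residue_Abs) simp_all

lemma residue_1: "residue (1 :: 'a padic_int) n = 1 mod int CARD('a) ^ n"
  unfolding one_padic_int_def by (rule residue_Abs) (simp only: mod_power_Suc_mod)

lemma residue_add: "residue (x + y :: 'a padic_int) n = (residue x n + residue y n) mod int CARD('a) ^ n"
  unfolding plus_padic_int_def
proof (rule residue_Abs)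
  show "(residue x n + residue y n) mod int CARD('a) ^ n =
    (residue x (Suc n) + residue y (Suc n)) mod int CARD('a) ^ Suc n mod int CARD('a) ^ n" for n
    by (simp only: mod_power_Suc_mod mod_add_eq
          residue_Suc[of x n, symmetric] residue_Suc[of y n, symmetric])
qed

lemma residue_uminus: "residue (- x :: 'a padic_int) n = (- residue x n) mod int CARD('a) ^ n"
  unfolding uminus_padic_int_def
proof (rule residue_Abs)
  show "(- residue x n) mod int CARD('a) ^ n =
    (- residue x (Suc n)) mod int CARD('a) ^ Suc n mod int CARD('a) ^ n" for n
    by (simp only: mod_power_Suc_mod mod_minus_eq residue_Suc[of x n, symmetric])
qed

lemma residue_diff: "residue (x - y :: 'a padic_int) n = (residue x n - residue y n) mod int CARD('a) ^ n"
  unfolding minus_padic_int_def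
proof (rule residue_Abs)
  show "(residue x n - residue y n) mod int CARD('a) ^ n =
    (residue x (Suc n) - residue y (Suc n)) mod int CARD('a) ^ Suc n mod int CARD('a) ^ n" for n
    by (simp only: mod_power_Suc_mod mod_diff_eq
          residue_Suc[of x n, symmetric] residue_Suc[of y n, symmetric])
qed

lemma residue_mult: "residue (x * y :: 'a padic_int) n = (residue x n * residue y n) mod int CARD('a) ^ n"
  unfolding times_padic_int_def
proof (rule residue_Abs)
  show "(residue x n * residue y n) mod int CARD('a) ^ n =
    (residue x (Suc n) * residue y (Suc n)) mod int CARD('a) ^ Suc n mod int CARD('a) ^ n" for n
    by (simp only: mod_power_Suc_mod mod_mult_eq
          residue_Suc[of x n, symmetric] residue_Suc[of y n, symmetric])
qed

lemmas residue_simps =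
  residue_add residue_uminus residue_diff residue_mult residue_0 residue_1

instance
proof
  fix a b c :: "'a padic_int"
  show "a + b + c = a + (b + c)"
    by (rule padic_int_eqI) (simp add: residue_simps mod_simps ac_simps)
  show "a + b = b + a"
    by (rule padic_int_eqI) (simp add: residue_simps ac_simps)
  show "0 + a = a"
    by (rule padic_int_eqI) (simp add: residue_simps)
  show "- a + a = 0"
    by (rule padic_int_eqI) (simp add: residue_simps mod_simps)
  show "a - b = a + - b"
    by (rule padic_int_eqI) (simp add: residue_simps mod_simps)
  show "a * b * c = a * (b * c)"
    by (rule padic_int_eqI) (simp add: residue_simps mod_simps ac_simps)
  show "a * b = b * a"
    by (rule padic_int_eqI) (simp add: residue_simps ac_simps)
  show "1 * a = a"
    by (rule padic_int_eqI) (simp add: residue_simps mod_simps)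
  show "(a + b) * c = a * c + b * c"
    by (rule padic_int_eqI) (simp add: residue_simps mod_simps algebra_simps)
  have "residue (0 :: 'a padic_int) 1 \<noteq> residue 1 1"
    using CARD_gt_1[where 'p = 'a] by (simp add: residue_simps)
  thus "(0 :: 'a padic_int) \<noteq> 1" by metis
qed

end

lemma residue_of_nat: "residue (of_nat k :: 'p :: prime_card padic_int) n = int k mod int CARD('p) ^ n"
  by (induction k) (simp_all add: residue_simps mod_simps)

lemma residue_of_int: "residue (of_int k :: 'p :: prime_card padic_int) n = k mod int CARD('p) ^ n"
  by (cases k rule: int_cases2) (simp_all add: residue_simps residue_of_nat mod_simps)

lemma residue_mono_mod:
  assumes "m \<le> n"
  shows "residue (x :: 'p :: prime_card padic_int) n mod int CARD('p) ^ m = residue x m"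
  using assms
proof (induction n rule: dec_induct)
  case (step n)
  have "residue x (Suc n) mod int CARD('p) ^ m
      = residue x (Suc n) mod int CARD('p) ^ n mod int CARD('p) ^ m"
    using step.hyps by (simp add: mod_mod_cancel le_imp_power_dvd)
  thus ?case by (simp only: residue_Suc step.IH)
qed simp

instance padic_int :: (prime_card) idom
proof
  fix x y :: "'a padic_int"
  let ?p = "int CARD('a)"
  assume "x \<noteq> 0" "y \<noteq> 0"
  then obtain m k where mk: "residue x m \<noteq> 0" "residue y k \<noteq> 0"
    by (metis padic_int_eqI residue_0)
  let ?X = "residue x (m + k)" and ?Y = "residue y (m + k)"
  have X: "\<not> ?p ^ m dvd ?X" and Y: "\<not> ?p ^ k dvd ?Y"
    using mk residue_mono_mod[of m "m + k" x] residue_mono_mod[of k "m + k" y] by auto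
  hence nz: "?X \<noteq> 0" "?Y \<noteq> 0" by auto
  have "multiplicity ?p (?X * ?Y) = multiplicity ?p ?X + multiplicity ?p ?Y"
    using nz prime_CARD[where 'p = 'a] by (intro prime_elem_multiplicity_mult_distrib) auto
  moreover have "multiplicity ?p ?X < m" "multiplicity ?p ?Y < k"
    using X Y multiplicity_dvd'[of m ?p ?X] multiplicity_dvd'[of k ?p ?Y] by (meson not_le)+
  ultimately have "\<not> ?p ^ (m + k) dvd ?X * ?Y"
    using nz CARD_gt_1[where 'p = 'a] by (subst power_dvd_iff_le_multiplicity) auto
  hence "residue (x * y) (m + k) \<noteq> 0"
    by (auto simp: residue_mult)
  thus "x * y \<noteq> 0" by (metis residue_0)
qed

type_synonym 'p padic = "'p padic_int fract"

text \<open>Every nonzero \<open>x\<close> has a unique expression \<open>x = p^k u\<close> with \<open>u\<close> a unit of the \<open>p\<close>-adic integers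
  (\<open>padic_val_exists\<close> and \<open>padic_val_eqI\<close> below), so the description operator is well-defined.\<close>

definition padic_val :: "'p :: prime_card padic \<Rightarrow> ereal" where
  "padic_val x = (if x = 0 then \<infinity> else
     ereal (of_int (THE k. \<exists>u. u dvd 1 \<and> x = of_nat CARD('p) powi k * Fract u 1)))"

lemma padic_int_unit_iff: "(x :: 'p :: prime_card padic_int) dvd 1 \<longleftrightarrow> residue x 1 \<noteq> 0"
proof
  assume "x dvd 1"
  then obtain y where "x * y = 1" by (metis dvdE)
  hence "residue (x * y) 1 = 1"
    using CARD_gt_1[where 'p = 'p] by (simp add: residue_1)
  thus "residue x 1 \<noteq> 0" by (auto simp: residue_mult)
next
  let ?p = "int CARD('p)"
  assume nz: "residue x 1 \<noteq> 0"
  have cop: "coprime (residue x n) (?p ^ n)" for n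
  proof (cases "n = 0")
    case False
    hence "residue x n mod ?p = residue x 1"
      using residue_mono_mod[of 1 n x] by simp
    hence "\<not> ?p dvd residue x n" using nz by auto
    hence "coprime ?p (residue x n)" using prime_CARD by (rule prime_imp_coprime[rotated])
    thus ?thesis by (simp add: coprime_commute)
  qed simp
  define P where "P n z \<longleftrightarrow> z mod ?p ^ n = z \<and> [residue x n * z = 1] (mod ?p ^ n)" for n z
  have unique: "z = z'" if "P n z" "P n z'" for n z z'
  proof -
    have "[residue x n * z = residue x n * z'] (mod ?p ^ n)"
      using that unfolding P_def by (meson cong_sym cong_trans)
    hence "[z = z'] (mod ?p ^ n)" using cop by (simp add: cong_mult_lcancel)
    thus ?thesis using that by (simp add: P_def cong_def)
  qed
  have "\<exists>z. P n z" for n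
  proof -
    obtain z where "[residue x n * z = 1] (mod ?p ^ n)"
      using cong_solve_coprime_int[OF cop] by blast
    hence "P n (z mod ?p ^ n)" by (simp add: P_def cong_def mod_simps)
    thus ?thesis by blast
  qed
  then obtain y where y: "\<And>n. P n (y n)" by metis
  have "y n = y (Suc n) mod ?p ^ n" for n
  proof (rule unique[OF y])
    have "[residue x (Suc n) * y (Suc n) = 1] (mod ?p ^ n)"
      using y[of "Suc n"] unfolding P_def by (auto intro: cong_dvd_modulus[of _ _ "?p ^ Suc n"])
    hence "[(residue x (Suc n) mod ?p ^ n) * (y (Suc n) mod ?p ^ n) = 1] (mod ?p ^ n)"
      by (simp add: cong_def mod_simps)
    thus "P n (y (Suc n) mod ?p ^ n)" by (simp add: P_def residue_Suc)
  qed
  hence "residue (Abs_padic_int y :: 'p padic_int) n = y n" for n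
    by (rule residue_Abs)
  hence "x * Abs_padic_int y = 1"
    using y by (intro padic_int_eqI) (simp add: residue_simps P_def cong_def)
  thus "x dvd 1" by (metis dvdI)
qed

lemma padic_int_decomp:
  assumes "(x :: 'p :: prime_card padic_int) \<noteq> 0"
  obtains k u where "u dvd 1" "x = of_nat CARD('p) ^ k * u"
proof -
  let ?p = "int CARD('p)"
  have p: "?p > 1" by (rule CARD_gt_1)
  have "\<exists>m. residue x m \<noteq> 0" using assms by (metis padic_int_eqI residue_0)
  then obtain m where m: "residue x m \<noteq> 0" "\<And>j. j < m \<Longrightarrow> residue x j = 0"
    using exists_least_iff[of "\<lambda>m. residue x m \<noteq> 0"] by auto
  have "residue x 0 = 0" using residue_mod[of x 0] by simp
  then obtain k where k: "m = Suc k" using m(1) by (cases m) auto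
  have dvd: "?p ^ k dvd residue x (n + k)" for n
    using residue_mono_mod[of k "n + k" x] m(2)[of k] k by auto
  define u where "u = (\<lambda>n. residue x (n + k) div ?p ^ k)"
  have pu: "residue x (n + k) = ?p ^ k * u n" for n using dvd[of n] by (simp add: u_def)
  have "u n = u (Suc n) mod ?p ^ n" for n
  proof -
    have "?p ^ k * (u (Suc n) mod ?p ^ n) = residue x (Suc n + k) mod ?p ^ (n + k)"
      by (simp only: pu mult_mod_right power_add mult.commute)
    also have "\<dots> = ?p ^ k * u n" by (simp add: residue_Suc pu[symmetric])
    finally show ?thesis using p by simp
  qed
  hence u: "residue (Abs_padic_int u :: 'p padic_int) n = u n" for n
    by (rule residue_Abs)
  have "Abs_padic_int u dvd (1 :: 'p padic_int)"
    unfolding padic_int_unit_iff u using pu[of 1] m(1) k by auto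
  moreover have "x = of_nat CARD('p) ^ k * Abs_padic_int u"
  proof (rule padic_int_eqI)
    fix n
    have "residue (of_nat CARD('p) ^ k * Abs_padic_int u :: 'p padic_int) n = ?p ^ k * u n mod ?p ^ n"
      using residue_of_nat[of "CARD('p) ^ k" n, where 'p = 'p]
      by (simp add: residue_simps u mod_simps)
    also have "\<dots> = residue x n"
      using residue_mono_mod[of n "n + k" x] by (simp add: pu)
    finally show "residue x n = residue (of_nat CARD('p) ^ k * Abs_padic_int u :: 'p padic_int) n" by simp
  qed
  ultimately show ?thesis by (rule that)
qed

lemma of_nat_Fract: "of_nat k = Fract (of_nat k) 1"
  by (induction k) (simp_all add: Zero_fract_def One_fract_def)

lemma of_int_Fract: "of_int k = Fract (of_int k) 1"
  by (cases k rule: int_cases2) (simp_all add: of_nat_Fract)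

lemma power_fract: "Fract x 1 ^ k = Fract (x ^ k) 1"
  by (induction k) (simp_all add: One_fract_def)

lemma fract_eq_0_iff: "Fract x 1 = 0 \<longleftrightarrow> x = 0"
  by (simp add: Zero_fract_def eq_fract)

lemma CARD_padic_nz: "(of_nat CARD('p) :: 'p :: prime_card padic) \<noteq> 0"
proof -
  have "residue (of_nat CARD('p) :: 'p padic_int) 2 \<noteq> 0"
    using CARD_gt_1[where 'p = 'p] by (simp add: residue_of_nat power2_eq_square)
  hence "(of_nat CARD('p) :: 'p padic_int) \<noteq> 0" by (metis residue_0)
  thus ?thesis by (simp add: of_nat_Fract Zero_fract_def eq_fract)
qed

lemma unit_times_power_eq:
  assumes "u dvd 1" "v dvd (1 :: 'p :: prime_card padic_int)"
    and "of_nat CARD('p) ^ k * u = v"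
  shows "k = 0"
proof (rule ccontr)
  assume "k \<noteq> 0"
  hence "of_nat CARD('p) dvd v" using assms(3) by (metis dvd_mult2 dvd_power not_gr_zero dvd_refl)
  hence "of_nat CARD('p) dvd (1 :: 'p padic_int)" using assms(2) dvd_trans by blast
  thus False by (simp add: padic_int_unit_iff residue_of_nat)
qed

lemma padic_val_exists:
  assumes "(x :: 'p :: prime_card padic) \<noteq> 0"
  shows "\<exists>k u. u dvd 1 \<and> x = of_nat CARD('p) powi k * Fract u 1"
proof -
  obtain a b where x: "x = Fract a b" "b \<noteq> 0" by (cases x)
  with assms have "a \<noteq> 0" by (auto simp: Zero_fract_def eq_fract)
  then obtain i u where a: "u dvd 1" "a = of_nat CARD('p) ^ i * u" by (rule padic_int_decomp)
  obtain j v where b: "v dvd 1" "b = of_nat CARD('p) ^ j * v" using x(2) by (rule padic_int_decomp)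
  obtain w where w: "v * w = 1" using b(1) by (metis dvdE)
  have w': "w dvd 1" using w by (metis dvd_triv_right)
  have "of_nat CARD('p) powi (int i - int j) * (Fract (u * w) 1 :: 'p padic)
      = (of_nat CARD('p) ^ i / of_nat CARD('p) ^ j) * Fract (u * w) 1"
    using CARD_padic_nz[where 'p = 'p] by (simp add: power_int_diff)
  also have "\<dots> = Fract (of_nat CARD('p) ^ i * (u * w)) (of_nat CARD('p) ^ j)"
    by (simp add: of_nat_Fract power_fract)
  also have "\<dots> = x"
    using x b w CARD_padic_nz[where 'p = 'p]
    by (simp add: x(1) a(2) b(2) eq_fract algebra_simps of_nat_Fract Zero_fract_def)
  finally have "x = of_nat CARD('p) powi (int i - int j) * Fract (u * w) 1" ..
  moreover have "u * w dvd 1" using a(1) w' by (metis mult_dvd_mono mult_1)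
  ultimately show ?thesis by blast
qed

lemma powi_unit_unique:
  assumes "u dvd 1" "v dvd 1"
    and "of_nat CARD('p) powi j * Fract u 1 = of_nat CARD('p) powi k * (Fract v 1 :: 'p :: prime_card padic)"
  shows "j = k"
  using assms
proof (induction j k arbitrary: u v rule: linorder_wlog)
  case (le j k)
  let ?p = "of_nat CARD('p)"
  obtain d where d: "k = j + int d" using le(1) by (metis zle_iff_zadd)
  have "?p powi j * Fract u 1 = ?p powi j * (?p ^ d * (Fract v 1 :: 'p padic))"
    using le(4) CARD_padic_nz[where 'p = 'p] by (simp add: d power_int_add mult.assoc)
  hence "Fract u 1 = ?p ^ d * (Fract v 1 :: 'p padic)"
    using CARD_padic_nz[where 'p = 'p] by simp
  hence "?p ^ d * v = u"
    by (simp add: of_nat_Fract power_fract eq_fract)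
  hence "d = 0" by (rule unit_times_power_eq[OF le(3,2)])
  thus ?case using d by simp
next
  case (sym j k)
  thus ?case by metis
qed

lemma padic_val_eqI:
  assumes "u dvd 1" "x = of_nat CARD('p) powi k * Fract u 1"
  shows "padic_val (x :: 'p :: prime_card padic) = ereal (of_int k)"
proof -
  have "u \<noteq> 0" using assms(1) by auto
  hence "x \<noteq> 0" using assms(2) CARD_padic_nz[where 'p = 'p] by (simp add: fract_eq_0_iff)
  moreover have "(THE k. \<exists>u. u dvd 1 \<and> x = of_nat CARD('p) powi k * Fract u 1) = k"
  proof (rule the_equality)
    show "\<exists>u. u dvd 1 \<and> x = of_nat CARD('p) powi k * Fract u 1" using assms by blast
  next
    fix j assume "\<exists>v. v dvd 1 \<and> x = of_nat CARD('p) powi j * Fract v 1"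
    then obtain v where "v dvd 1" "x = of_nat CARD('p) powi j * Fract v 1" by blast
    thus "j = k" using powi_unit_unique[of v u j k] assms by simp
  qed
  ultimately show ?thesis by (simp add: padic_val_def)
qed

lemma padic_val_minus: "padic_val (- x :: 'p :: prime_card padic) = padic_val x"
proof (cases "x = 0")
  case False
  then obtain k u where ku: "u dvd 1" "x = of_nat CARD('p) powi k * Fract u 1"
    using padic_val_exists by blast
  have "- u dvd 1" "- x = of_nat CARD('p) powi k * Fract (- u) 1"
    using ku by (simp_all flip: minus_fract)
  thus ?thesis using padic_val_eqI ku by metis
qed simp

lemma padic_val_of_int:
  assumes "m \<noteq> 0"
  shows "padic_val (of_int m :: 'p :: prime_card padic) = ereal (real (multiplicity (int CARD('p)) m))"
proof -
  let ?p = "int CARD('p)"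
  obtain r where r: "m = ?p ^ multiplicity ?p m * r" "\<not> ?p dvd r"
    using multiplicity_decompose'[of m ?p] assms CARD_gt_1[where 'p = 'p] by auto
  have "of_int r dvd (1 :: 'p padic_int)"
    using r(2) by (simp add: padic_int_unit_iff residue_of_int dvd_eq_mod_eq_0)
  moreover have "(of_int m :: 'p padic) = of_nat CARD('p) powi int (multiplicity ?p m) * Fract (of_int r) 1"
    by (subst r(1)) (simp flip: of_int_Fract)
  ultimately have "padic_val (of_int m :: 'p padic) = ereal (of_int (int (multiplicity ?p m)))"
    by (rule padic_val_eqI)
  thus ?thesis by simp
qed

section \<open>Extension of the valuation\<close>

definition min_poly :: "'a :: field alg_closure \<Rightarrow> 'a poly" where
  "min_poly a = (THE m. Polynomial.lead_coeff m = 1 \<and> Factorial_Ring.irreducible m \<and> poly (map_poly to_ac m) a = 0)"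

lemma to_ac_poly_add: "map_poly to_ac (f + g) = map_poly to_ac f + map_poly to_ac g"
  by (rule poly_eqI) (simp add: coeff_map_poly)

lemma to_ac_poly_mult: "map_poly to_ac (f * g) = map_poly to_ac f * map_poly to_ac g"
  by (rule poly_eqI) (simp add: coeff_map_poly Polynomial.coeff_mult to_ac_sum)

lemma min_poly_ex1:
  fixes a :: "'a :: field alg_closure"
  shows "\<exists>!m. Polynomial.lead_coeff m = 1 \<and> Factorial_Ring.irreducible m \<and> poly (map_poly to_ac m) a = 0"
proof -
  define S where "S = {q :: 'a poly. q \<noteq> 0 \<and> poly (map_poly to_ac q) a = 0}"
  obtain q0 where "q0 \<in> S" using alg_closure_algebraic[of a] by (auto simp: S_def)
  then obtain q where q: "q \<in> S" "\<And>g. g \<in> S \<Longrightarrow> Polynomial.degree q \<le> Polynomial.degree g"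
    using ex_has_least_nat[of "\<lambda>q. q \<in> S" q0 Polynomial.degree] by blast
  define m where "m = Polynomial.smult (inverse (Polynomial.lead_coeff q)) q"
  have deg: "Polynomial.degree m = Polynomial.degree q" and monic: "Polynomial.lead_coeff m = 1"
    using q(1) by (simp_all add: m_def S_def)
  have m: "m \<in> S"
    using q(1) by (simp add: S_def m_def map_poly_smult)
  have least: "Polynomial.degree m \<le> Polynomial.degree g" if "g \<in> S" for g using q(2) that deg by simp
  have unit: "g dvd 1" if "m = f * g" "f \<in> S" for f g
  proof -
    have "f \<noteq> 0" "g \<noteq> 0" using that m by (auto simp: S_def)
    hence "Polynomial.degree g = 0" using least[OF that(2)] that(1) by (simp add: degree_mult_eq)
    thus ?thesis using \<open>g \<noteq> 0\<close> by (metis is_unit_iff_degree)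
  qed
  have "Factorial_Ring.irreducible m"
  proof (rule irreducibleI)
    show "m \<noteq> 0" using m by (simp add: S_def)
    show "\<not> m dvd 1"
    proof
      assume "m dvd 1"
      then obtain c where "m = [:c:]" by (elim is_unit_polyE)
      thus False using m by (auto simp: S_def map_poly_pCons)
    qed
  next
    fix f g assume fg: "m = f * g"
    hence "f \<noteq> 0" "g \<noteq> 0" "f \<in> S \<or> g \<in> S" using m by (auto simp: S_def to_ac_poly_mult)
    thus "f dvd 1 \<or> g dvd 1" using unit[of f g] unit[of g f] fg by (auto simp: mult.commute)
  qed
  moreover have "m' = m" if m': "Polynomial.lead_coeff m' = 1" "Factorial_Ring.irreducible m'"
    "poly (map_poly to_ac m') a = 0" for m'
  proof -
    have "map_poly to_ac m' = map_poly to_ac (m' div m) * map_poly to_ac m + map_poly to_ac (m' mod m)"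
      by (simp flip: to_ac_poly_mult to_ac_poly_add)
    hence "poly (map_poly to_ac (m' mod m)) a = 0" using m' m by (simp add: S_def)
    moreover have "m' mod m = 0 \<or> Polynomial.degree (m' mod m) < Polynomial.degree m"
      using m by (intro degree_mod_less) (simp add: S_def)
    ultimately have "m' mod m = 0"
      using least[of "m' mod m"] unfolding S_def by (metis (mono_tags, lifting) mem_Collect_eq not_le)
    then obtain g where g: "m' = m * g" by (metis mod_0_imp_dvd dvdE)
    hence "g dvd 1" using m'(2) \<open>Factorial_Ring.irreducible m\<close> irreducibleD irreducible_not_unit by blast
    then obtain c where "g = [:c:]" by (elim is_unit_polyE)
    thus ?thesis using g m'(1) monic by (auto split: if_splits)
  qed
  moreover have "poly (map_poly to_ac m) a = 0" using m by (simp add: S_def)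
  ultimately show ?thesis using monic by blast
qed

definition padic_val_ext :: "'p :: prime_card padic alg_closure \<Rightarrow> ereal" where
  "padic_val_ext a =
     ereal (1 / real (Polynomial.degree (min_poly a))) * padic_val (Polynomial.coeff (min_poly a) 0)"

lemma padic_val_ext_to_ac: "padic_val_ext (to_ac x) = padic_val x"
proof -
  have "min_poly (to_ac x) = [:- x, 1:]"
    unfolding min_poly_def
    by (rule the1_equality[OF min_poly_ex1]) (simp add: irreducible_linear_field_poly map_poly_pCons)
  thus ?thesis by (simp add: padic_val_ext_def padic_val_minus flip: one_ereal_def)
qed

text \<open>Up to isomorphism, finite-degree extensions of a field are the intermediate fields of
  its algebraic closure that are finite-dimensional over it.\<close>

definition finite_extension :: "'a :: field alg_closure set \<Rightarrow> bool" where
  "finite_extension K \<longleftrightarrow>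
     subfield K ring_of_type_algebra \<and> range to_ac \<subseteq> K \<and>
     ring.finite_dimension ring_of_type_algebra (range to_ac) K"

section \<open>Integer matrices\<close>

text \<open>The rank is taken over the rationals, since \<open>vec_space.rank\<close> requires a field.\<close>

definition int_rank :: "int mat \<Rightarrow> nat" where
  "int_rank A = vec_space.rank (dim_row A) (map_mat rat_of_int A)"

definition determinantal_divisor :: "int mat \<Rightarrow> nat \<Rightarrow> int" where
  "determinantal_divisor A i = Gcd {Determinant.det (submatrix A I J) | I J.
     I \<subseteq> {..<dim_row A} \<and> J \<subseteq> {..<dim_col A} \<and> card I = i \<and> card J = i}"

text \<open>\<open>invariant_factors A s\<close> states that \<open>diag(s, 0, \<dots>, 0)\<close> is a Smith normal form of the square
  matrix \<open>A\<close>.  It determines the entries of \<open>s\<close> up to sign, to which the valuation is insensitive.\<close>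

definition invariant_factors :: "int mat \<Rightarrow> int list \<Rightarrow> bool" where
  "invariant_factors A s \<longleftrightarrow>
     length s = int_rank A \<and> 0 \<notin> set s \<and> sorted_wrt (dvd) s \<and>
     (\<exists>P Q. P \<in> carrier_mat (dim_row A) (dim_row A) \<and> invertible_mat P \<and>
            Q \<in> carrier_mat (dim_row A) (dim_row A) \<and> invertible_mat Q \<and>
            P * A * Q = mat_diag (dim_row A) (\<lambda>i. if i < length s then s ! i else 0))"

definition p_characterized :: "'p :: prime_card itself \<Rightarrow> int mat \<Rightarrow> bool" where
  "p_characterized _ A \<longleftrightarrow>
     (\<forall>i \<in> {1..int_rank A}.
        padic_val (of_int (Polynomial.coeff (char_poly A) (dim_row A - i)) :: 'p padic) =
        padic_val (of_int (determinantal_divisor A i) :: 'p padic))"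

text \<open>The eigenvalues are the roots of the characteristic polynomial, listed with algebraic
  multiplicity.\<close>

definition nonzero_eigenvalues_in :: "'a :: field set \<Rightarrow> 'a mat \<Rightarrow> 'a multiset" where
  "nonzero_eigenvalues_in K A = {# x \<in># proots (char_poly A). x \<in> K \<and> x \<noteq> 0 #}"

definition p_correspondent :: "'p :: prime_card itself \<Rightarrow> int mat \<Rightarrow> bool" where
  "p_correspondent _ A \<longleftrightarrow>
     (\<exists>(K :: 'p padic alg_closure set) evs s.
        finite_extension K \<and>
        mset evs = nonzero_eigenvalues_in K (map_mat of_int A) \<and>
        length evs = int_rank A \<and>
        sorted (map padic_val_ext evs) \<and>
        invariant_factors A s \<and>
        (\<forall>i < int_rank A. padic_val (of_int (s ! i) :: 'p padic) = padic_val_ext (evs ! i)))"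

end

theory Submission
  imports Defs "Jordan_Normal_Form.DL_Rank_Submatrix"
begin

text \<open>
  Let \<open>s\<close> be the list of invariant factors of \<open>A\<close>, let \<open>r\<close> be its length, and let \<open>\<sigma>\<close> be the list of
  their valuations, which is nondecreasing because each invariant factor divides the next.  The \<open>i\<close>-th
  determinantal divisor is the product of the first \<open>i\<close> invariant factors
  (\<open>determinantal_divisor_eq\<close>), and the characteristic polynomial is \<open>x^(n - r) h\<close> with \<open>h\<close> monic of
  degree \<open>r\<close> (\<open>power_dvd_char_poly\<close>).  So \<open>A\<close> being characterized says that the coefficient of
  \<open>x^(r - i)\<close> in \<open>h\<close> has valuation \<open>\<sigma>_1 + \<dots> + \<sigma>_i\<close>: all these points lie on the Newton polygon of \<open>h\<close>,
  and its slopes are the \<open>\<sigma>_i\<close>.  The classical theorem that the slopes of the Newton polygon are the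
  valuations of the roots (\<open>newton_slopes_proots\<close>) finishes the proof.

  That theorem has an arithmetic core, \<open>irreducible_gauss_ge\<close>: the Newton polygon of an irreducible
  polynomial over the p-adic numbers is a single segment.  It depends on completeness, through the
  version \<open>newton_vertex_factorization\<close> of Hensel's lemma, by which a polynomial splits at a vertex
  of its Newton polygon.  The polygon itself is handled through its supporting lines, that is, through
  the Gauss valuations \<open>gauss_eq t\<close> for real weights \<open>t\<close>.  They are additive on products
  (\<open>gauss_eq_mult\<close>), so from the irreducible factors one obtains that the value of \<open>h\<close> is the sum of
  \<open>min v t\<close> over the valuations \<open>v\<close> of its roots (\<open>gauss_eq_proots\<close>).  The coefficients of \<open>h\<close> give the
  same sum over the \<open>\<sigma>_i\<close> (\<open>gauss_eq_of_coeff_vals\<close>), and these sums, as functions of \<open>t\<close>, determine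
  the multiset (\<open>sorted_list_eq_if_sum_min_eq\<close>).
\<close>

section \<open>The p-adic valuation\<close>

lemma padic_val_eq_infinity_iff: "padic_val (x :: 'p :: prime_card padic) = \<infinity> \<longleftrightarrow> x = 0"
  by (simp add: padic_val_def)

lemma padic_val_0 [simp]: "padic_val (0 :: 'p :: prime_card padic) = \<infinity>"
  by (simp add: padic_val_def)

lemma padic_val_finite_cases:
  assumes "(x :: 'p :: prime_card padic) \<noteq> 0"
  obtains k where "padic_val x = ereal (of_int k)"
  using padic_val_exists[OF assms] padic_val_eqI by metis

lemma padic_val_1 [simp]: "padic_val (1 :: 'p :: prime_card padic) = 0"
  using padic_val_of_int[of 1, where 'p = 'p] by simp

lemma padic_val_mult:
  "padic_val (x * y :: 'p :: prime_card padic) = padic_val x + padic_val y"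
proof (cases "x = 0 \<or> y = 0")
  case True
  then show ?thesis
  proof
    assume "y = 0"
    moreover have "padic_val x \<noteq> -\<infinity>" by (auto simp: padic_val_def)
    ultimately show ?thesis by simp
  next
    assume "x = 0"
    moreover have "padic_val y \<noteq> -\<infinity>" by (auto simp: padic_val_def)
    ultimately show ?thesis by simp
  qed
next
  case False
  then obtain k u l w where u: "u dvd 1" "x = of_nat CARD('p) powi k * Fract u 1"
    and w: "w dvd 1" "y = of_nat CARD('p) powi l * Fract w 1"
    using padic_val_exists by metis
  have "padic_val (x * y) = ereal (of_int (k + l))"
  proof (rule padic_val_eqI)
    show "u * w dvd 1" using u(1) w(1) by (metis mult_dvd_mono mult_1)
    show "x * y = of_nat CARD('p) powi (k + l) * Fract (u * w) 1"
      using u(2) w(2) CARD_padic_nz[where 'p = 'p] by (simp add: power_int_add ac_simps)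
  qed
  then show ?thesis using padic_val_eqI[OF u] padic_val_eqI[OF w] by simp
qed

lemma padic_val_divide:
  assumes "(y :: 'p :: prime_card padic) \<noteq> 0" "padic_val y = ereal b" "ereal a \<le> padic_val x"
  shows "ereal (a - b) \<le> padic_val (x / y)"
proof (cases "x = 0")
  case False
  have "padic_val x = padic_val (x / y) + padic_val y"
    using assms(1) by (simp flip: padic_val_mult)
  moreover obtain k where "padic_val (x / y) = ereal (of_int k)"
    using padic_val_finite_cases[of "x / y"] False assms(1) by auto
  ultimately show ?thesis using assms(2,3) by simp
qed simp

lemma padic_val_CARD_powi: "padic_val (of_nat CARD('p) powi k :: 'p :: prime_card padic) = ereal (of_int k)"
  by (rule padic_val_eqI[of 1]) (simp_all flip: One_fract_def)

lemma padic_val_Fract_nonneg: "0 \<le> padic_val (Fract z 1 :: 'p :: prime_card padic)"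
proof (cases "z = 0")
  case False
  then obtain k u where "u dvd 1" "z = of_nat CARD('p) ^ k * u" by (rule padic_int_decomp)
  then have "padic_val (Fract z 1) = ereal (of_int (int k))"
    by (intro padic_val_eqI[of u]) (simp_all add: of_nat_Fract power_fract)
  then show ?thesis by simp
qed (simp add: fract_collapse)

lemma padic_val_nonneg_iff:
  "0 \<le> padic_val (x :: 'p :: prime_card padic) \<longleftrightarrow> (\<exists>z. x = Fract z 1)"
proof
  assume nn: "0 \<le> padic_val x"
  show "\<exists>z. x = Fract z 1"
  proof (cases "x = 0")
    case False
    then obtain k u where u: "u dvd 1" "x = of_nat CARD('p) powi k * Fract u 1"
      using padic_val_exists by metis
    then have "k \<ge> 0" using padic_val_eqI[OF u] nn by simp
    then have "x = Fract (of_nat CARD('p) ^ nat k * u) 1"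
      using u(2) by (simp add: of_nat_Fract power_fract power_int_def)
    then show ?thesis ..
  qed (metis Zero_fract_def)
qed (auto simp: padic_val_Fract_nonneg)

lemma padic_val_add_ge:
  assumes "c \<le> padic_val (x :: 'p :: prime_card padic)" "c \<le> padic_val y"
  shows "c \<le> padic_val (x + y)"
proof -
  \<comment> \<open>If \<open>x\<close> has the smaller valuation, then \<open>y / x\<close> is a p-adic integer, and so is \<open>1 + y / x\<close>.\<close>
  have *: "padic_val x \<le> padic_val (x + y)" if le: "padic_val x \<le> padic_val y" for x y :: "'p padic"
  proof (cases "x = 0")
    case False
    then obtain k where k: "padic_val x = ereal (of_int k)" by (rule padic_val_finite_cases)
    have "ereal (of_int k - of_int k) \<le> padic_val (y / x)"
      by (rule padic_val_divide) (use False k le in auto)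
    then have "0 \<le> padic_val (y / x)" by (simp add: zero_ereal_def)
    then obtain z where z: "y / x = Fract z 1" by (auto simp: padic_val_nonneg_iff)
    have "x + y = x * Fract (1 + z) 1"
    proof -
      have "x + y = x * (1 + y / x)" using False by (simp add: field_simps)
      also have "1 + y / x = Fract (1 + z) 1" by (simp add: z One_fract_def)
      finally show ?thesis .
    qed
    then show ?thesis
      using padic_val_Fract_nonneg[of "1 + z"] by (simp add: padic_val_mult add_increasing2)
  qed (use le in simp)
  show ?thesis
  proof (cases "padic_val x \<le> padic_val y")
    case True
    then show ?thesis using *[of x y] assms(1) by simp
  next
    case False
    then have "padic_val y \<le> padic_val (y + x)" by (intro *) simp
    then show ?thesis using assms(2) by (simp add: add.commute)
  qed
qed

lemma padic_val_diff_ge: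
  assumes "c \<le> padic_val (x :: 'p :: prime_card padic)" "c \<le> padic_val y"
  shows "c \<le> padic_val (x - y)"
  using padic_val_add_ge[of c x "- y"] assms by (simp add: padic_val_minus)

lemma padic_val_sum_ge:
  assumes "\<And>i. i \<in> I \<Longrightarrow> c \<le> padic_val (f i :: 'p :: prime_card padic)"
  shows "c \<le> padic_val (\<Sum>i\<in>I. f i)"
  using assms by (induction I rule: infinite_finite_induct) (auto intro: padic_val_add_ge)

lemma padic_val_add_eq:
  assumes "padic_val (x :: 'p :: prime_card padic) < padic_val y"
  shows "padic_val (x + y) = padic_val x"
proof (rule antisym)
  show "padic_val x \<le> padic_val (x + y)" using assms by (intro padic_val_add_ge) auto
  show "padic_val (x + y) \<le> padic_val x"
  proof (rule ccontr)
    assume contra: "\<not> ?thesis"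
    then have "min (padic_val (x + y)) (padic_val y) \<le> padic_val (x + y - y)"
      by (intro padic_val_diff_ge) auto
    then show False using contra assms by (auto simp: min_def split: if_splits)
  qed
qed

lemma padic_val_eq_infinityI:
  assumes "\<And>c. ereal c \<le> padic_val (x :: 'p :: prime_card padic)"
  shows "x = 0"
  using assms padic_val_eq_infinity_iff by (metis ereal_top)

lemma padic_val_sum_greater: 
  assumes "finite I" "c < \<infinity>" "\<And>i. i \<in> I \<Longrightarrow> c < padic_val (f i :: 'p :: prime_card padic)"
  shows "c < padic_val (\<Sum>i\<in>I. f i)"
  using assms(1,3)
proof (induction I rule: finite_induct)
  case (insert i I)
  have "min (padic_val (f i)) (padic_val (sum f I)) \<le> padic_val (f i + sum f I)"
    by (intro padic_val_add_ge) auto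
  moreover have "c < min (padic_val (f i)) (padic_val (sum f I))" using insert by simp
  ultimately have "c < padic_val (f i + sum f I)" by order
  then show ?case using insert.hyps by simp
qed (use assms(2) in simp)

section \<open>Completeness\<close>

lemma padic_val_mult_ge:
  assumes "ereal a \<le> padic_val x" "ereal b \<le> padic_val y"
  shows "ereal (a + b) \<le> padic_val (x * y)"
  using add_mono[OF assms] by (simp add: padic_val_mult)

text \<open>Residues and valuation describe the same topology: this is the bridge by which a limit,
  built residue by residue, is controlled in terms of the valuation.\<close>

lemma padic_val_Fract_ge_iff:
  "ereal (real k) \<le> padic_val (Fract w 1 :: 'p :: prime_card padic) \<longleftrightarrow> residue w k = 0"
proof (cases "w = 0")
  case False
  let ?p = "int CARD('p)"
  from False obtain j u where u: "u dvd 1" "w = of_nat CARD('p) ^ j * u" by (rule padic_int_decomp)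
  have val: "padic_val (Fract w 1) = ereal (of_int (int j))"
    by (rule padic_val_eqI[OF u(1)]) (simp add: u(2) of_nat_Fract power_fract)
  have res: "residue w k = ?p ^ j * residue u k mod ?p ^ k"
    using residue_of_nat[of "CARD('p) ^ j" k, where 'p = 'p]
    by (simp add: u(2) residue_mult mod_simps)
  show ?thesis
  proof (cases "k \<le> j")
    case True
    then have "?p ^ k dvd ?p ^ j * residue u k" by (simp add: le_imp_power_dvd)
    then show ?thesis using True by (simp add: val res)
  next
    case False
    have "residue w k \<noteq> 0"
    proof
      assume "residue w k = 0"
      then have "?p ^ k dvd ?p ^ j * residue u k" by (simp add: res mod_eq_0_iff_dvd)
      moreover have "?p ^ k = ?p ^ j * ?p ^ (k - j)" using False by (simp flip: power_add)
      ultimately have "?p ^ (k - j) dvd residue u k" using CARD_gt_1[where 'p = 'p] by simp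
      moreover have "?p dvd ?p ^ (k - j)" using False by (intro dvd_power) simp
      ultimately have "?p dvd residue u k" by (rule dvd_trans[rotated])
      then have "residue u 1 = 0" using residue_mono_mod[of 1 k u] False by simp
      then show False using u(1) padic_int_unit_iff by blast
    qed
    then show ?thesis using False by (simp add: val)
  qed
qed (simp add: fract_collapse residue_0)

lemma padic_val_telescope:
  assumes "\<And>k. ereal (c + real k * \<delta>) \<le> padic_val (x (Suc k) - x k :: 'p :: prime_card padic)"
    and "\<delta> \<ge> 0" "k \<le> l"
  shows "ereal (c + real k * \<delta>) \<le> padic_val (x l - x k)"
  using assms(3)
proof (induction l rule: dec_induct)
  case (step l)
  have "ereal (c + real k * \<delta>) \<le> ereal (c + real l * \<delta>)"
    using step.hyps assms(2) by (simp add: mult_right_mono)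
  also have "\<dots> \<le> padic_val (x (Suc l) - x l)" by (rule assms(1))
  finally have "ereal (c + real k * \<delta>) \<le> padic_val ((x (Suc l) - x l) + (x l - x k))"
    using step.IH by (intro padic_val_add_ge)
  then show ?case by simp
qed simp

lemma padic_int_complete:
  assumes "\<And>k. residue (w (Suc k)) k = residue (w k :: 'p :: prime_card padic_int) k"
  shows "\<exists>z :: 'p padic_int. \<forall>k. residue z k = residue (w k) k"
proof -
  have "residue (Abs_padic_int (\<lambda>k. residue (w k) k) :: 'p padic_int) k = residue (w k) k" for k
    by (rule residue_Abs) (simp add: residue_Suc assms)
  then show ?thesis by blast
qed

text \<open>Completeness in the quantitative form needed for Hensel's lemma: a sequence whose \<open>k\<close>-th
  increment has valuation at least \<open>c + k \<delta>\<close> converges, with the same bounds for the distance to the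
  limit.  The gain \<open>\<delta>\<close> per step is an arbitrary positive real, because the slopes of a Newton polygon
  need not be integers.\<close>

lemma padic_complete:
  fixes x :: "nat \<Rightarrow> 'p :: prime_card padic"
  assumes x: "\<And>k. ereal (c + real k * \<delta>) \<le> padic_val (x (Suc k) - x k)" and "\<delta> > 0"
  shows "\<exists>L. \<forall>k. ereal (c + real k * \<delta>) \<le> padic_val (L - x k)"
proof -
  \<comment> \<open>Division by \<open>P\<close> moves the differences \<open>x k - x 0\<close> into the p-adic integers.\<close>
  define P where "P = (of_nat CARD('p) powi \<lfloor>c\<rfloor> :: 'p padic)"
  have P0: "P \<noteq> 0" and valP: "padic_val P = ereal \<lfloor>c\<rfloor>"
    using CARD_padic_nz[where 'p = 'p] by (auto simp: P_def padic_val_CARD_powi)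
  \<comment> \<open>From index \<open>m j\<close> on, all differences have valuation at least \<open>c + j\<close>, so the first \<open>j\<close> residues are fixed.\<close>
  define m where "m j = nat \<lceil>real j / \<delta>\<rceil>" for j
  have m: "real j \<le> real (m j) * \<delta>" for j
  proof -
    have "real j / \<delta> \<le> real (m j)" unfolding m_def by linarith
    then show ?thesis using \<open>\<delta> > 0\<close> by (simp add: field_simps)
  qed
  have m_mono: "m j \<le> m (Suc j)" for j
    unfolding m_def using \<open>\<delta> > 0\<close> by (intro nat_mono ceiling_mono) (simp add: divide_right_mono)
  note tele = padic_val_telescope[of c \<delta> x, OF x less_imp_le[OF \<open>\<delta> > 0\<close>]]
  have scale: "ereal (b - \<lfloor>c\<rfloor>) \<le> padic_val (y / P)" if "ereal b \<le> padic_val y" for b y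
    using padic_val_divide[OF P0 valP that] by simp
  have "\<exists>w. (x (m j) - x 0) / P = Fract w 1" for j
  proof -
    have "ereal (c - \<lfloor>c\<rfloor>) \<le> padic_val ((x (m j) - x 0) / P)"
      using tele[of 0 "m j"] by (intro scale) simp
    then have "0 \<le> padic_val ((x (m j) - x 0) / P)"
      by (rule order_trans[rotated]) simp
    then show ?thesis by (simp add: padic_val_nonneg_iff)
  qed
  then obtain w where w: "\<And>j. (x (m j) - x 0) / P = Fract (w j) 1" by metis
  have "residue (w (Suc j)) j = residue (w j) j" for j
  proof -
    have "Fract (w (Suc j) - w j) 1 = Fract (w (Suc j)) 1 - Fract (w j) 1" by simp
    also have "\<dots> = (x (m (Suc j)) - x (m j)) / P"
      unfolding w[symmetric] by (simp add: diff_divide_distrib)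
    finally have "Fract (w (Suc j) - w j) 1 = (x (m (Suc j)) - x (m j)) / P" .
    moreover have "ereal (real j) \<le> ereal (c + real (m j) * \<delta> - \<lfloor>c\<rfloor>)"
      using m[of j] by simp linarith
    moreover have "ereal (c + real (m j) * \<delta> - \<lfloor>c\<rfloor>) \<le> padic_val ((x (m (Suc j)) - x (m j)) / P)"
      by (rule scale[OF tele[OF m_mono]])
    ultimately have "ereal (real j) \<le> padic_val (Fract (w (Suc j) - w j) 1)"
      by (simp only:)
    then have "residue (w (Suc j) - w j) j = 0" by (simp only: padic_val_Fract_ge_iff)
    then have "int CARD('p) ^ j dvd residue (w (Suc j)) j - residue (w j) j"
      by (simp add: residue_diff mod_eq_0_iff_dvd)
    then have "residue (w (Suc j)) j mod int CARD('p) ^ j = residue (w j) j mod int CARD('p) ^ j"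
      by (simp only: mod_eq_dvd_iff)
    then show ?thesis by simp
  qed
  from padic_int_complete[of w, OF this] obtain z :: "'p padic_int" where z: "\<And>j. residue z j = residue (w j) j" by blast
  define L where "L = x 0 + P * Fract z 1"
  have L: "ereal (real j + \<lfloor>c\<rfloor>) \<le> padic_val (L - x (m j))" for j
  proof -
    have "x (m j) = x 0 + P * Fract (w j) 1" using w[of j] P0 by (simp add: field_simps)
    then have "L - x (m j) = P * (Fract z 1 - Fract (w j) 1)"
      by (simp add: L_def algebra_simps del: diff_fract)
    then have "L - x (m j) = P * Fract (z - w j) 1" by simp
    moreover have "ereal (real j) \<le> padic_val (Fract (z - w j) 1)"
      unfolding padic_val_Fract_ge_iff by (simp add: residue_diff z)
    ultimately show ?thesis
      using padic_val_mult_ge[of "\<lfloor>c\<rfloor>" P "real j"]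
      by (simp add: valP add.commute)
  qed
  have "ereal (c + real k * \<delta>) \<le> padic_val (L - x k)" for k
  proof -
    define j where "j = nat \<lceil>max (c + real k * \<delta> - \<lfloor>c\<rfloor>) (real k * \<delta>)\<rceil>"
    have j: "c + real k * \<delta> \<le> real j + \<lfloor>c\<rfloor>" "real k * \<delta> \<le> real j"
      unfolding j_def by linarith+
    have "real k * \<delta> \<le> real (m j) * \<delta>" using j(2) m[of j] by linarith
    then have "k \<le> m j" using \<open>\<delta> > 0\<close> by simp
    moreover have "ereal (c + real k * \<delta>) \<le> padic_val (L - x (m j))"
      by (rule order_trans[OF _ L[of j]]) (use j(1) in simp)
    ultimately have "ereal (c + real k * \<delta>) \<le> padic_val ((L - x (m j)) + (x (m j) - x k))"
      by (intro padic_val_add_ge tele)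
    then show ?thesis by simp
  qed
  then show ?thesis by blast
qed

section \<open>Gauss valuations of polynomials\<close>

text \<open>For a real number \<open>t\<close>, giving the variable the valuation \<open>t\<close> extends \<open>padic_val\<close> to
  polynomials: the value of \<open>f\<close> is the minimum of \<open>padic_val (coeff f i) + i t\<close>.  In terms of the Newton
  polygon, it is the intercept of the supporting line of slope \<open>- t\<close>.  The value is expressed by two
  relations, one for the lower bound and one for equality, which avoids minima over an index set that
  is empty for the zero polynomial.\<close>

definition gauss_ge :: "real \<Rightarrow> real \<Rightarrow> 'p :: prime_card padic poly \<Rightarrow> bool" where
  "gauss_ge t c f \<longleftrightarrow> (\<forall>i. ereal (c - real i * t) \<le> padic_val (coeff f i))"

definition gauss_eq :: "real \<Rightarrow> real \<Rightarrow> 'p :: prime_card padic poly \<Rightarrow> bool" where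
  "gauss_eq t c f \<longleftrightarrow> gauss_ge t c f \<and> (\<exists>i. padic_val (coeff f i) = ereal (c - real i * t))"

lemma gauss_geD: "gauss_ge t c f \<Longrightarrow> ereal (c - real i * t) \<le> padic_val (coeff f i)"
  by (simp add: gauss_ge_def)

lemma gauss_ge_0 [simp]: "gauss_ge t c 0"
  by (simp add: gauss_ge_def)

lemma gauss_ge_1: "gauss_ge t 0 1"
proof -
  have "ereal (0 - real i * t) \<le> padic_val (coeff 1 i :: 'a padic)" for i :: nat
    by (cases "i = 0") (simp_all add: zero_ereal_def)
  then show ?thesis by (simp add: gauss_ge_def)
qed

lemma gauss_ge_mono: "gauss_ge t c f \<Longrightarrow> c' \<le> c \<Longrightarrow> gauss_ge t c' f"
  unfolding gauss_ge_def by (blast intro: order_trans[of "ereal _" "ereal _"] ereal_less_eq(3)[THEN iffD2] diff_right_mono)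

lemma gauss_ge_add: "gauss_ge t c f \<Longrightarrow> gauss_ge t c g \<Longrightarrow> gauss_ge t c (f + g)"
  by (simp add: gauss_ge_def padic_val_add_ge)

lemma gauss_ge_diff: "gauss_ge t c f \<Longrightarrow> gauss_ge t c g \<Longrightarrow> gauss_ge t c (f - g)"
  by (simp add: gauss_ge_def padic_val_diff_ge)

lemma gauss_ge_mult:
  assumes "gauss_ge t c f" "gauss_ge t c' g"
  shows "gauss_ge t (c + c') (f * g)"
  unfolding gauss_ge_def coeff_mult
proof (intro allI padic_val_sum_ge)
  fix i j :: nat assume "j \<in> {..i}"
  then have "ereal (c + c' - real i * t) = ereal ((c - real j * t) + (c' - real (i - j) * t))"
    by (simp add: of_nat_diff algebra_simps)
  also have "\<dots> \<le> padic_val (coeff f j * coeff g (i - j))"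
    using assms by (intro padic_val_mult_ge gauss_geD)
  finally show "ereal (c + c' - real i * t) \<le> padic_val (coeff f j * coeff g (i - j))" .
qed

lemma gauss_eq_last:
  assumes "gauss_eq t c f"
  obtains i where "padic_val (coeff f i) = ereal (c - real i * t)"
    "\<And>j. j > i \<Longrightarrow> ereal (c - real j * t) < padic_val (coeff f j)"
proof -
  define S where "S = {i. padic_val (coeff f i) = ereal (c - real i * t)}"
  have "S \<subseteq> {..degree f}"
  proof
    fix i assume "i \<in> S"
    then have "coeff f i \<noteq> 0" by (auto simp: S_def)
    then show "i \<in> {..degree f}" by (simp add: le_degree)
  qed
  then have fin: "finite S" by (rule finite_subset) simp
  moreover have "S \<noteq> {}" using assms by (auto simp: S_def gauss_eq_def)
  ultimately have "Max S \<in> S" by (rule Max_in)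
  moreover have "ereal (c - real j * t) < padic_val (coeff f j)" if "j > Max S" for j
  proof -
    have "j \<notin> S" using Max_ge[OF fin, of j] that by auto
    moreover have "ereal (c - real j * t) \<le> padic_val (coeff f j)"
      using assms by (intro gauss_geD) (simp add: gauss_eq_def)
    ultimately show ?thesis by (auto simp: S_def)
  qed
  ultimately show ?thesis using that by (auto simp: S_def)
qed

text \<open>The lemma of Gauss.  The last coefficients of \<open>f\<close> and \<open>g\<close> that attain the minimum contribute to
  one coefficient of the product a term whose valuation is strictly smaller than that of all the
  other terms, so nothing can cancel it.\<close>

theorem gauss_eq_mult:
  assumes f: "gauss_eq t c f" and g: "gauss_eq t c' (g :: 'p :: prime_card padic poly)"
  shows "gauss_eq t (c + c') (f * g)"
proof -
  have ge: "gauss_ge t c f" "gauss_ge t c' g" using f g by (auto simp: gauss_eq_def)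
  obtain i where i: "padic_val (coeff f i) = ereal (c - real i * t)"
    "\<And>j. j > i \<Longrightarrow> ereal (c - real j * t) < padic_val (coeff f j)"
    using f by (rule gauss_eq_last) blast
  obtain k where k: "padic_val (coeff g k) = ereal (c' - real k * t)"
    "\<And>j. j > k \<Longrightarrow> ereal (c' - real j * t) < padic_val (coeff g j)"
    using g by (rule gauss_eq_last) blast
  have val: "padic_val (coeff f i * coeff g k) = ereal (c + c' - real (i + k) * t)"
    by (simp add: padic_val_mult i k algebra_simps)
  have "padic_val (coeff f i * coeff g k) <
      padic_val (\<Sum>j\<in>{..i + k} - {i}. coeff f j * coeff g (i + k - j))"
  proof (rule padic_val_sum_greater)
    fix j assume j: "j \<in> {..i + k} - {i}"
    have *: "padic_val (coeff f i * coeff g k) =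
        ereal (c - real j * t) + ereal (c' - real (i + k - j) * t)"
      using j by (simp add: val of_nat_diff algebra_simps)
    show "padic_val (coeff f i * coeff g k) < padic_val (coeff f j * coeff g (i + k - j))"
    proof (cases "j > i")
      case True
      then show ?thesis
        unfolding * unfolding padic_val_mult
        using i(2)[of j] gauss_geD[OF ge(2), of "i + k - j"]
        by (cases "padic_val (coeff f j)"; cases "padic_val (coeff g (i + k - j))") auto
    next
      case False
      then have "i + k - j > k" using j by auto
      then show ?thesis
        unfolding * unfolding padic_val_mult
        using k(2)[of "i + k - j"] gauss_geD[OF ge(1), of j]
        by (cases "padic_val (coeff f j)"; cases "padic_val (coeff g (i + k - j))") auto
    qed
  qed (simp_all add: val)
  then have "padic_val (coeff f i * coeff g k + (\<Sum>j\<in>{..i + k} - {i}. coeff f j * coeff g (i + k - j)))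
      = ereal (c + c' - real (i + k) * t)"
    unfolding val[symmetric] by (rule padic_val_add_eq)
  moreover have "coeff (f * g) (i + k) =
      coeff f i * coeff g k + (\<Sum>j\<in>{..i + k} - {i}. coeff f j * coeff g (i + k - j))"
    unfolding coeff_mult by (subst sum.remove[of _ i]) auto
  ultimately have "padic_val (coeff (f * g) (i + k)) = ereal (c + c' - real (i + k) * t)" by simp
  then show ?thesis
    using gauss_ge_mult[OF ge] unfolding gauss_eq_def by blast
qed

lemma gauss_eq_unique:
  assumes "gauss_eq t c f" "gauss_eq t c' f"
  shows "c = c'"
proof -
  have "c \<le> c'" if eqs: "gauss_eq t c f" "gauss_eq t c' f" for c c'
  proof -
    obtain i where "padic_val (coeff f i) = ereal (c' - real i * t)"
      using eqs(2) by (auto simp: gauss_eq_def)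
    moreover have "ereal (c - real i * t) \<le> padic_val (coeff f i)"
      using eqs(1) by (intro gauss_geD) (simp add: gauss_eq_def)
    ultimately show ?thesis by simp
  qed
  then show ?thesis using assms by (simp add: antisym)
qed

text \<open>When the leading coefficient of the divisor attains its Gauss valuation, division with
  remainder loses nothing: each step of the long division subtracts a multiple of \<open>G\<close> with at least
  the Gauss valuation of the dividend.\<close>

lemma gauss_division:
  assumes G: "gauss_ge t w G" and lead: "padic_val (lead_coeff G) = ereal (w - real (degree G) * t)"
    and deg: "degree G > 0" and f: "gauss_ge t c f"
  shows "\<exists>q r. f = q * G + r \<and> degree r < degree G \<and> gauss_ge t (c - w) q \<and> gauss_ge t c r"
  using f
proof (induction "degree f" arbitrary: f rule: less_induct)
  case less
  show ?case
  proof (cases "degree f < degree G")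
    case True
    then show ?thesis using less.prems by (intro exI[of _ 0] exI[of _ f]) simp
  next
    case False
    define n where "n = degree f - degree G"
    define b where "b = lead_coeff f / lead_coeff G"
    define q where "q = monom b n"
    have G0: "lead_coeff G \<noteq> 0" using deg by auto
    have "ereal (c - real (degree f) * t - (w - real (degree G) * t)) \<le> padic_val b"
      unfolding b_def by (rule padic_val_divide[OF G0 lead gauss_geD[OF less.prems]])
    moreover have "c - real (degree f) * t - (w - real (degree G) * t) = c - w - real n * t"
      using False by (simp add: n_def of_nat_diff algebra_simps)
    ultimately have q: "gauss_ge t (c - w) q"
      by (simp add: gauss_ge_def q_def)
    have qG: "gauss_ge t c (q * G)" using gauss_ge_mult[OF q G] by simp
    have b0: "b \<noteq> 0" using G0 False deg by (auto simp: b_def)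
    have "degree (f - q * G) < degree f"
    proof (rule degree_lessI)
      have degqG: "degree (q * G) = degree f"
        using b0 False G0 by (subst degree_mult_eq) (auto simp: q_def degree_monom_eq n_def)
      show "f - q * G \<noteq> 0 \<or> 0 < degree f" using False deg by simp
      have "coeff (q * G) (degree f) = lead_coeff f"
        using G0 b0 lead_coeff_mult[of q G] by (simp add: degqG) (simp add: q_def b_def degree_monom_eq)
      then show "\<forall>k\<ge>degree f. coeff (f - q * G) k = 0"
        using degqG by (auto simp: le_less coeff_eq_0)
    qed
    from less.hyps[OF this gauss_ge_diff[OF less.prems qG]] obtain q' r where
      *: "f - q * G = q' * G + r" "degree r < degree G" "gauss_ge t (c - w) q'" "gauss_ge t c r" by blast
    show ?thesis
      using * q by (intro exI[of _ "q + q'"] exI[of _ r]) (auto simp: algebra_simps gauss_ge_add)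
  qed
qed

text \<open>Completeness, coefficient by coefficient; the degree bound makes the limit a polynomial.\<close>

lemma poly_complete:
  fixes f :: "nat \<Rightarrow> 'p :: prime_card padic poly"
  assumes step: "\<And>k. gauss_ge t (c + real k * \<delta>) (f (Suc k) - f k)" and "\<delta> > 0"
    and deg: "\<And>k. degree (f k) \<le> D"
  obtains F where "degree F \<le> D" "\<And>k. gauss_ge t (c + real k * \<delta>) (F - f k)"
proof -
  have ex: "\<exists>L. \<forall>k. ereal (c - real i * t + real k * \<delta>) \<le> padic_val (L - coeff (f k) i)" for i
  proof (rule padic_complete[OF _ \<open>\<delta> > 0\<close>])
    show "ereal (c - real i * t + real k * \<delta>) \<le> padic_val (coeff (f (Suc k)) i - coeff (f k) i)" for k
      using gauss_geD[OF step, of k i] by (simp add: algebra_simps)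
  qed
  from choice[of "\<lambda>i L. \<forall>k. ereal (c - real i * t + real k * \<delta>) \<le> padic_val (L - coeff (f k) i)"] ex
  obtain L where L: "\<And>i k. ereal (c - real i * t + real k * \<delta>) \<le> padic_val (L i - coeff (f k) i)"
    by blast
  define F where "F = (\<Sum>i\<le>D. monom (L i) i)"
  have coeff_F: "coeff F i = (if i \<le> D then L i else 0)" for i
    by (simp add: F_def coeff_sum)
  have "ereal (c + real k * \<delta> - real i * t) \<le> padic_val (coeff (F - f k) i)" for k i
  proof (cases "i \<le> D")
    case True
    then show ?thesis using L[of i k] by (simp add: coeff_F algebra_simps)
  next
    case False
    then show ?thesis using deg[of k] by (simp add: coeff_F coeff_eq_0)
  qed
  then have "\<And>k. gauss_ge t (c + real k * \<delta>) (F - f k)" by (simp add: gauss_ge_def)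
  moreover have "degree F \<le> D" by (rule degree_le) (simp add: coeff_F)
  ultimately show ?thesis by (rule that[rotated])
qed

section \<open>Factorization at a vertex of the Newton polygon\<close>

lemma uniform_gap_finite:
  fixes a :: "'i \<Rightarrow> real" and b :: "'i \<Rightarrow> ereal"
  assumes "finite I" "\<And>i. i \<in> I \<Longrightarrow> ereal (a i) < b i"
  shows "\<exists>\<delta>>0. \<forall>i\<in>I. ereal (a i + \<delta>) \<le> b i"
  using assms
proof (induction I rule: finite_induct)
  case empty
  show ?case by (rule exI[of _ 1]) simp
next
  case (insert i I)
  then obtain \<delta> where \<delta>: "\<delta> > 0" "\<And>j. j \<in> I \<Longrightarrow> ereal (a j + \<delta>) \<le> b j" by auto
  obtain e where e: "ereal (a i) < ereal e" "ereal e \<le> b i"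
    using ereal_dense2[OF insert.prems[of i]] by (auto intro: less_imp_le)
  have "ereal (a j + min \<delta> (e - a i)) \<le> b j" if "j \<in> insert i I" for j
  proof (cases "j = i")
    case True
    then show ?thesis using order_trans[of "ereal (a j + min \<delta> (e - a i))" "ereal e" "b i"] e by simp
  next
    case False
    then have "ereal (a j + \<delta>) \<le> b j" using that \<delta>(2) by blast
    then show ?thesis by (rule order_trans[rotated]) simp
  qed
  then show ?case using e \<delta>(1) by (intro exI[of _ "min \<delta> (e - a i)"]) auto
qed

text \<open>Hensel's lemma for Newton polygons: a polynomial splits at the last point where the supporting
  line of slope \<open>- t\<close> meets its Newton polygon.  The part \<open>G\<close> of \<open>g\<close> up to degree \<open>m\<close> is a first approximation to
  a factor, with cofactor close to 1, because the higher coefficients lie above the line by some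
  \<open>\<delta> > 0\<close>.  If \<open>g = q G + r\<close>, then replacing \<open>G\<close> by \<open>G + r\<close> leaves the error \<open>(1 - q) r\<close>, which is smaller than
  \<open>r\<close> by the factor \<open>1 - q\<close> of Gauss valuation at least \<open>\<delta>\<close>; dividing this error by \<open>G + r\<close> gives the next
  cofactor and remainder.  The limit of the approximations divides \<open>g\<close>.\<close>

theorem newton_vertex_factorization:
  fixes g :: "'p :: prime_card padic poly"
  assumes g: "gauss_ge t w g" and m: "m > 0" "padic_val (coeff g m) = ereal (w - real m * t)"
    and strict: "\<And>i. i > m \<Longrightarrow> ereal (w - real i * t) < padic_val (coeff g i)"
  obtains G q where "g = q * G" "degree G = m"
proof -
  define d where "d = degree g"
  obtain \<delta> where \<delta>: "\<delta> > 0" "\<And>i. i \<in> {m<..d} \<Longrightarrow> ereal (w - real i * t + \<delta>) \<le> padic_val (coeff g i)"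
    using uniform_gap_finite[of "{m<..d}" "\<lambda>i. w - real i * t" "\<lambda>i. padic_val (coeff g i)"] strict
    by (metis finite_greaterThanAtMost greaterThanAtMost_iff)
  have gm: "coeff g m \<noteq> 0" using m(2) by auto
  then have md: "m \<le> d" by (simp add: d_def le_degree)
  \<comment> \<open>The invariant of the iteration, and the relation between two consecutive approximations.\<close>
  define P where "P k = (\<lambda>(G, q, r). degree G = m \<and> coeff G m = coeff g m \<and> gauss_ge t w G \<and>
      g = q * G + r \<and> degree r < m \<and> gauss_ge t \<delta> (q - 1) \<and> gauss_ge t (w + \<delta> + real k * \<delta>) r)" for k
  define Q where "Q k = (\<lambda>(G :: 'p padic poly, q :: 'p padic poly, r) (G', q', r' :: 'p padic poly). G' = G + r \<and> gauss_ge t (\<delta> + real k * \<delta>) (q' - q))" for k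
  have "\<exists>f. \<forall>k. P k (f k) \<and> Q k (f k) (f (Suc k))"
  proof (rule dependent_nat_choice)
    define G where "G = poly_cutoff (Suc m) g"
    have coeff_G: "coeff G i = (if i \<le> m then coeff g i else 0)" for i
      by (simp add: G_def coeff_poly_cutoff less_Suc_eq_le)
    have deg: "degree G = m"
      using gm by (intro antisym degree_le le_degree) (auto simp: coeff_G)
    have G: "gauss_ge t w G" using g by (auto simp: gauss_ge_def coeff_G)
    have "gauss_ge t (w + \<delta>) (g - G)"
      unfolding gauss_ge_def
    proof
      fix i show "ereal (w + \<delta> - real i * t) \<le> padic_val (coeff (g - G) i)"
        using \<delta>(2)[of i] by (cases "i \<le> m"; cases "i \<le> d") (auto simp: coeff_G d_def coeff_eq_0 algebra_simps)
    qed
    from gauss_division[OF G _ _ this] obtain q r where qr: "g - G = q * G + r" "degree r < m"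
      "gauss_ge t \<delta> q" "gauss_ge t (w + \<delta>) r"
      using m by (auto simp: deg coeff_G)
    \<comment> \<open>Dividing \<open>g - G\<close> and not \<open>g\<close> shows that the first cofactor is close to 1.\<close>
    have "(1 + q) * G + r = G + (q * G + r)" by (simp add: algebra_simps)
    also have "\<dots> = g" by (simp flip: qr(1))
    finally have "P 0 (G, 1 + q, r)"
      using G qr(2-4) by (simp add: P_def deg coeff_G)
    then show "\<exists>T. P 0 T" ..
  next
    fix T k assume "P k T"
    obtain G q r where T: "T = (G, q, r)" by (cases T)
    have P: "degree G = m" "coeff G m = coeff g m" "gauss_ge t w G" "g = q * G + r" "degree r < m"
      "gauss_ge t \<delta> (q - 1)" "gauss_ge t (w + \<delta> + real k * \<delta>) r"
      using \<open>P k T\<close> by (auto simp: P_def T)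
    define G' where "G' = G + r"
    have deg: "degree G' = m" using P(1,5) by (simp add: G'_def degree_add_eq_left)
    have lead: "coeff G' m = coeff g m" using P(2,5) by (simp add: G'_def coeff_eq_0)
    have "gauss_ge t w r" using \<delta>(1) by (intro gauss_ge_mono[OF P(7)]) simp
    then have G': "gauss_ge t w G'" unfolding G'_def by (intro gauss_ge_add P)
    have "gauss_ge t (\<delta> + (w + \<delta> + real k * \<delta>)) (0 - (q - 1) * r)"
      by (intro gauss_ge_diff gauss_ge_mult P gauss_ge_0)
    then have *: "gauss_ge t (w + \<delta> + real (Suc k) * \<delta>) ((1 - q) * r)"
      by (simp add: algebra_simps)
    from gauss_division[OF G' _ _ *] obtain q' r' where qr: "(1 - q) * r = q' * G' + r'" "degree r' < m"
      "gauss_ge t (w + \<delta> + real (Suc k) * \<delta> - w) q'" "gauss_ge t (w + \<delta> + real (Suc k) * \<delta>) r'"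
      using m by (auto simp: deg lead)
    have q': "gauss_ge t (\<delta> + real k * \<delta>) q'" "gauss_ge t \<delta> q'"
      using \<delta>(1) by (auto intro!: gauss_ge_mono[OF qr(3)] simp: algebra_simps)
    have "g = (q + q') * G' + r'"
    proof -
      have "(q + q') * G' + r' = q * G + (q * r + (q' * G' + r'))" by (simp add: G'_def algebra_simps)
      also have "\<dots> = g" unfolding qr(1)[symmetric] P(4) by (simp add: algebra_simps)
      finally show ?thesis ..
    qed
    moreover have "gauss_ge t \<delta> (q + q' - 1)"
      using gauss_ge_add[OF P(6) q'(2)] by (simp add: algebra_simps)
    ultimately have "P (Suc k) (G', q + q', r')"
      using deg lead G' qr by (simp add: P_def)
    moreover have "Q k T (G', q + q', r')" using q' by (simp add: Q_def T G'_def)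
    ultimately show "\<exists>T'. P (Suc k) T' \<and> Q k T T'" by blast
  qed
  then obtain f where f: "\<And>k. P k (f k)" "\<And>k. Q k (f k) (f (Suc k))" by blast
  define G q r where "G k = fst (f k)" and "q k = fst (snd (f k))" and "r k = snd (snd (f k))" for k
  have eqf: "f k = (G k, q k, r k)" for k by (simp add: G_def q_def r_def)
  have P: "degree (G k) = m" "coeff (G k) m = coeff g m" "gauss_ge t w (G k)" "g = q k * G k + r k"
      "degree (r k) < m" "gauss_ge t \<delta> (q k - 1)" "gauss_ge t (w + \<delta> + real k * \<delta>) (r k)" for k
    using f(1)[of k] by (auto simp: P_def eqf)
  have Q: "G (Suc k) = G k + r k" "gauss_ge t (\<delta> + real k * \<delta>) (q (Suc k) - q k)" for k
    using f(2)[of k] by (auto simp: Q_def eqf)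
  have degq: "degree (q k) \<le> d" for k
  proof (cases "q k = 0")
    case False
    have G0: "G k \<noteq> 0" using P(1)[of k] m(1) by auto
    have "degree (q k) \<le> degree (q k * G k)" using False G0 by (simp add: degree_mult_eq)
    also have "q k * G k = g - r k" using P(4)[of k] by (simp add: algebra_simps)
    also have "degree (g - r k) \<le> d" using P(5)[of k] md by (intro degree_diff_le) (auto simp: d_def)
    finally show ?thesis .
  qed simp
  obtain Gl where Gl: "degree Gl \<le> m" "\<And>k. gauss_ge t (w + \<delta> + real k * \<delta>) (Gl - G k)"
  proof (rule poly_complete[of t "w + \<delta>" \<delta> G m])
    show "gauss_ge t (w + \<delta> + real k * \<delta>) (G (Suc k) - G k)" for k using P(7) by (simp add: Q)
  qed (use \<delta>(1) P(1) in auto)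
  obtain ql where ql: "degree ql \<le> d" "\<And>k. gauss_ge t (\<delta> + real k * \<delta>) (ql - q k)"
    by (rule poly_complete[of t \<delta> \<delta> q d]) (use \<delta>(1) Q(2) degq in auto)
  \<comment> \<open>A polynomial whose Gauss valuation exceeds all bounds vanishes.\<close>
  have small: "coeff h i = 0" if h: "\<And>k. gauss_ge t (w + real k * \<delta>) h" for h :: "'p padic poly" and i
  proof (rule padic_val_eq_infinityI)
    fix c
    define k where "k = nat \<lceil>(c + real i * t - w) / \<delta>\<rceil>"
    have "(c + real i * t - w) / \<delta> \<le> real k" unfolding k_def by linarith
    then have "c \<le> w + real k * \<delta> - real i * t" using \<delta>(1) by (simp add: field_simps)
    then show "ereal c \<le> padic_val (coeff h i)"
      by (intro order_trans[OF _ gauss_geD[OF h[of k], of i]]) simp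
  qed
  have "g - ql * Gl = 0"
  proof (rule poly_eqI, unfold coeff_0, rule small)
    fix k
    have r: "gauss_ge t (w + real k * \<delta>) (r k)"
      using \<delta>(1) by (intro gauss_ge_mono[OF P(7)]) simp
    have dq: "gauss_ge t (\<delta> + real k * \<delta> + w) ((ql - q k) * G k)"
      by (intro gauss_ge_mult ql P)
    have "gauss_ge t 0 (1 + (q k - 1) + (ql - q k))"
      using \<delta>(1) by (intro gauss_ge_add gauss_ge_1 gauss_ge_mono[OF P(6)] gauss_ge_mono[OF ql(2)]) auto
    then have dG: "gauss_ge t (0 + (w + \<delta> + real k * \<delta>)) (ql * (Gl - G k))"
      by (intro gauss_ge_mult Gl) simp
    have "gauss_ge t (w + real k * \<delta>) (r k - (ql - q k) * G k - ql * (Gl - G k))"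
      using \<delta>(1) by (intro gauss_ge_diff r gauss_ge_mono[OF dq] gauss_ge_mono[OF dG]) auto
    moreover have "r k - (ql - q k) * G k - ql * (Gl - G k) = g - ql * Gl"
      using P(4)[of k] by (simp add: algebra_simps)
    ultimately show "gauss_ge t (w + real k * \<delta>) (g - ql * Gl)" by simp
  qed
  moreover have "degree Gl = m"
  proof (rule antisym[OF Gl(1) le_degree])
    have "coeff Gl m - coeff g m = 0" 
    proof (rule padic_val_eq_infinityI)
      fix c
      define k where "k = nat \<lceil>(c + real m * t - w - \<delta>) / \<delta>\<rceil>"
      have "(c + real m * t - w - \<delta>) / \<delta> \<le> real k" unfolding k_def by linarith
      then have "c \<le> w + \<delta> + real k * \<delta> - real m * t" using \<delta>(1) by (simp add: field_simps)
      then have "ereal c \<le> ereal (w + \<delta> + real k * \<delta> - real m * t)" by simp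
      also have "\<dots> \<le> padic_val (coeff (Gl - G k) m)" by (rule gauss_geD[OF Gl(2)])
      also have "coeff (Gl - G k) m = coeff Gl m - coeff g m" by (simp add: P(2))
      finally show "ereal c \<le> padic_val (coeff Gl m - coeff g m)" .
    qed
    then show "coeff Gl m \<noteq> 0" using gm by simp
  qed
  ultimately show ?thesis by (intro that[of ql Gl]) simp_all
qed

text \<open>The Newton polygon of an irreducible polynomial is a single segment.  For the weight \<open>\<mu>\<close> that
  gives both end points the same value, a coefficient below the segment would make the minimum
  smaller than that value; then it is attained only at interior indices, and the last of them is a
  vertex at which the polynomial splits.\<close>

theorem irreducible_gauss_ge:
  fixes g :: "'p :: prime_card padic poly"
  assumes irr: "irreducible g" and monic: "lead_coeff g = 1"
    and \<mu>: "padic_val (coeff g 0) = ereal (real (degree g) * \<mu>)"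
  shows "gauss_ge \<mu> (real (degree g) * \<mu>) g"
proof (rule ccontr)
  assume not_ge: "\<not> ?thesis"
  define d where "d = degree g"
  define S where "S = {i. coeff g i \<noteq> 0}"
  define \<phi> where "\<phi> i = real_of_ereal (padic_val (coeff g i)) + real i * \<mu>" for i
  have val: "padic_val (coeff g i) = ereal (\<phi> i - real i * \<mu>)" if "i \<in> S" for i
    using that by (auto simp: S_def \<phi>_def elim: padic_val_finite_cases)
  have S_le: "S \<subseteq> {..d}" by (auto simp: S_def d_def le_degree)
  then have fin: "finite S" by (rule finite_subset) simp
  have S: "0 \<in> S" "d \<in> S" using \<mu> monic by (auto simp: S_def d_def)
  have ends: "\<phi> 0 = real d * \<mu>" "\<phi> d = real d * \<mu>"
    using \<mu> monic by (simp_all add: \<phi>_def d_def)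
  define w where "w = Min (\<phi> ` S)"
  have w_le: "w \<le> \<phi> i" if "i \<in> S" for i using fin that by (simp add: w_def)
  have g: "gauss_ge \<mu> w g"
    unfolding gauss_ge_def
  proof
    fix i show "ereal (w - real i * \<mu>) \<le> padic_val (coeff g i)"
      using val[of i] w_le[of i] by (cases "i \<in> S") (auto simp: S_def)
  qed
  have "w < real d * \<mu>"
    using not_ge gauss_ge_mono[OF g, of "real d * \<mu>"] by (force simp: d_def)
  define T where "T = {i \<in> S. \<phi> i = w}"
  have T: "finite T" "T \<noteq> {}"
  proof -
    have "w \<in> \<phi> ` S" unfolding w_def using fin S by (intro Min_in) auto
    then show "T \<noteq> {}" by (auto simp: T_def)
  qed (use fin in \<open>simp add: T_def\<close>)
  define m where "m = Max T"
  have m: "m \<in> S" "\<phi> m = w" using Max_in[OF T] by (auto simp: T_def m_def)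
  have "m \<noteq> 0" "m \<noteq> d" using m(2) ends \<open>w < real d * \<mu>\<close> by (intro notI; simp)+
  with m(1) S_le have md: "0 < m" "m < d" by auto
  obtain G q where Gq: "g = q * G" "degree G = m"
  proof (rule newton_vertex_factorization[OF g md(1)])
    show "padic_val (coeff g m) = ereal (w - real m * \<mu>)" using val[OF m(1)] m(2) by simp
    fix i assume "i > m"
    show "ereal (w - real i * \<mu>) < padic_val (coeff g i)"
    proof (cases "i \<in> S")
      case True
      have "i \<notin> T" using Max_ge[OF T(1), of i] \<open>i > m\<close> by (auto simp: m_def)
      then show ?thesis using True w_le[OF True] val[OF True] by (auto simp: T_def)
    qed (simp add: S_def)
  qed
  have "q \<noteq> 0" "G \<noteq> 0" using Gq(1) irr by auto
  then have "degree q > 0" using Gq md by (auto simp: d_def degree_mult_eq)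
  then have "\<not> q dvd 1" "\<not> G dvd 1"
    using Gq(2) md \<open>q \<noteq> 0\<close> \<open>G \<noteq> 0\<close> by (auto simp: is_unit_iff_degree)
  then show False using irreducibleD[OF irr Gq(1)] by blast
qed

text \<open>The minimum over a segment is attained at one of its ends: at the constant term if \<open>\<mu> \<le> t\<close>, and at
  the leading term otherwise.\<close>

theorem irreducible_gauss_eq:
  fixes g :: "'p :: prime_card padic poly"
  assumes irr: "irreducible g" and monic: "lead_coeff g = 1"
    and \<mu>: "padic_val (coeff g 0) = ereal (real (degree g) * \<mu>)"
  shows "gauss_eq t (real (degree g) * min \<mu> t) g"
  unfolding gauss_eq_def gauss_ge_def
proof (intro conjI allI)
  fix i
  show "ereal (real (degree g) * min \<mu> t - real i * t) \<le> padic_val (coeff g i)"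
  proof (cases "i \<le> degree g")
    case True
    then have "real (degree g - i) * min \<mu> t \<le> real (degree g - i) * \<mu>" "real i * min \<mu> t \<le> real i * t"
      by (simp_all add: mult_left_mono)
    then have "real (degree g) * min \<mu> t - real i * t \<le> real (degree g) * \<mu> - real i * \<mu>"
      using True by (simp add: of_nat_diff algebra_simps)
    then show ?thesis
      by (intro order_trans[OF _ gauss_geD[OF irreducible_gauss_ge[OF assms]]]) simp
  qed (simp add: coeff_eq_0)
next
  show "\<exists>i. padic_val (coeff g i) = ereal (real (degree g) * min \<mu> t - real i * t)"
  proof (cases "\<mu> \<le> t")
    case True
    then show ?thesis using \<mu> by (intro exI[of _ 0]) (simp add: min_def)
  next
    case False
    then show ?thesis using monic by (intro exI[of _ "degree g"]) (simp add: min_def zero_ereal_def)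
  qed
qed

section \<open>Slopes of the Newton polygon and valuations of the roots\<close>

lemma size_proots_alg_closed:
  fixes p :: "'a :: alg_closed_field poly"
  shows "size (proots p) = degree p"
proof (cases "p = 0")
  case False
  then obtain A where A: "size A = degree p" "p = smult (lead_coeff p) (\<Prod>x\<in>#A. [:- x, 1:])"
    using alg_closed_imp_factorization by blast
  have "proots p = proots (smult (lead_coeff p) (\<Prod>x\<in>#A. [:- x, 1:]))" using A(2) by simp
  also have "\<dots> = proots (\<Prod>x\<in>#A. [:- x, 1:])" using False by simp
  also have "\<dots> = A"
  proof (induction A)
    case (add x A)
    have "(\<Prod>x\<in>#A. [:- x, 1:]) \<noteq> 0" by (auto simp: prod_mset_zero_iff)
    then have "proots (\<Prod>y\<in>#add_mset x A. [:- y, 1:]) = {#x#} + A"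
      unfolding image_mset_add_mset prod_mset.add_mset
      by (subst proots_mult) (simp_all add: add.IH)
    then show ?case by simp
  qed simp
  finally show ?thesis using A(1) by simp
qed simp

lemma map_poly_to_ac_eq_0_iff [simp]: "map_poly to_ac p = 0 \<longleftrightarrow> p = 0"
  by (simp add: poly_eq_iff coeff_map_poly)

lemma degree_map_poly_to_ac [simp]: "degree (map_poly to_ac p) = degree p"
  by (simp add: degree_map_poly)

lemma min_poly_eqI:
  assumes "lead_coeff g = 1" "irreducible g" "poly (map_poly to_ac g) a = 0"
  shows "min_poly a = g"
  unfolding min_poly_def by (rule the1_equality[OF min_poly_ex1]) (use assms in blast)

lemma padic_val_ext_root:
  fixes g :: "'p :: prime_card padic poly"
  assumes "lead_coeff g = 1" "irreducible g" "padic_val (coeff g 0) = ereal (real (degree g) * \<mu>)"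
    and "a \<in># proots (map_poly to_ac g)"
  shows "padic_val_ext a = ereal \<mu>"
proof -
  have g0: "g \<noteq> 0" using assms(1) by auto
  have "min_poly a = g" using assms g0 by (intro min_poly_eqI) auto
  moreover have "degree g > 0"
    using assms(2) g0 is_unit_iff_degree[of g] irreducible_not_unit[of g] by auto
  ultimately show ?thesis using assms(3) by (simp add: padic_val_ext_def)
qed

text \<open>The Gauss valuations of a polynomial are determined by the valuations of its roots.  As
  \<open>padic_val_ext\<close> is defined through minimal polynomials, it is constant on the roots of an irreducible
  factor, where \<open>irreducible_gauss_eq\<close> gives the claim; both sides are additive under products.\<close>

theorem gauss_eq_proots:
  fixes h :: "'p :: prime_card padic poly"
  assumes "lead_coeff h = 1" "coeff h 0 \<noteq> 0"
  shows "(\<forall>a \<in># proots (map_poly to_ac h). \<bar>padic_val_ext a\<bar> \<noteq> \<infinity>) \<and>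
    gauss_eq t (\<Sum>a\<in>#proots (map_poly to_ac h). min (real_of_ereal (padic_val_ext a)) t) h"
  using assms
proof (induction "degree h" arbitrary: h rule: less_induct)
  case less
  show ?case
  proof (cases "degree h = 0")
    case True
    with less.prems have "h = 1" by (metis monic_degree_0)
    then show ?thesis
      using gauss_ge_1 by (auto simp: gauss_eq_def zero_ereal_def intro: exI[of _ 0])
  next
    case False
    then obtain g k where gk: "irreducible g" "h = g * k" "lead_coeff g = 1"
      using irreducible_monic_factor[of h] by auto
    have nz: "g \<noteq> 0" "k \<noteq> 0" using gk less.prems by auto
    have g_deg: "degree g > 0"
      using gk(1) nz(1) is_unit_iff_degree[of g] irreducible_not_unit[of g] by auto
    have k_monic: "lead_coeff k = 1" using gk less.prems(1) by (simp add: lead_coeff_mult)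
    have coeff0: "coeff g 0 \<noteq> 0" "coeff k 0 \<noteq> 0"
      using less.prems(2) by (auto simp: gk(2) coeff_mult_0)
    have "degree k < degree h" using nz g_deg by (simp add: gk(2) degree_mult_eq)
    note IH = less.hyps[OF this k_monic coeff0(2)]
    obtain v where v: "padic_val (coeff g 0) = ereal (of_int v)"
      using padic_val_finite_cases[OF coeff0(1)] .
    define \<mu> where "\<mu> = of_int v / real (degree g)"
    have \<mu>: "padic_val (coeff g 0) = ereal (real (degree g) * \<mu>)"
      using g_deg by (simp add: \<mu>_def v)
    have ext: "padic_val_ext a = ereal \<mu>" if "a \<in># proots (map_poly to_ac g)" for a
      by (rule padic_val_ext_root[OF gk(3,1) \<mu> that])
    have "(\<Sum>a\<in>#proots (map_poly to_ac g). min (real_of_ereal (padic_val_ext a)) t)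
        = (\<Sum>a\<in>#proots (map_poly to_ac g). min \<mu> t)"
      by (intro arg_cong[of _ _ sum_mset] image_mset_cong) (simp add: ext)
    also have "\<dots> = real (degree g) * min \<mu> t" by (simp add: size_proots_alg_closed)
    finally have sum_g: "(\<Sum>a\<in>#proots (map_poly to_ac g). min (real_of_ereal (padic_val_ext a)) t)
        = real (degree g) * min \<mu> t" .
    have roots: "proots (map_poly to_ac h) = proots (map_poly to_ac g) + proots (map_poly to_ac k)"
      using nz by (simp add: gk(2) to_ac_poly_mult proots_mult)
    have "gauss_eq t (real (degree g) * min \<mu> t +
        (\<Sum>a\<in>#proots (map_poly to_ac k). min (real_of_ereal (padic_val_ext a)) t)) h"
      unfolding gk(2) using IH by (intro gauss_eq_mult irreducible_gauss_eq gk \<mu>) blast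
    then show ?thesis using IH ext by (auto simp: roots sum_g)
  qed
qed

text \<open>A finite multiset of reals is determined by the function that sends \<open>t\<close> to the sum of the
  minima with \<open>t\<close>: if the smallest elements \<open>a < b\<close> differed, then at \<open>t = b\<close> the sum for the second
  list would be as large as possible, and the other one would not.\<close>

lemma sorted_list_eq_if_sum_min_eq:
  fixes xs ys :: "real list"
  assumes "length xs = length ys" "sorted xs" "sorted ys"
    and "\<And>t. (\<Sum>x\<leftarrow>xs. min x t) = (\<Sum>y\<leftarrow>ys. min y t)"
  shows "xs = ys"
  using assms
proof (induction xs ys rule: list_induct2)
  case (Cons x xs y ys)
  have *: "\<not> a < b" if sorted: "sorted (b # bs)" and len: "length as = length bs"
    and eq: "\<And>t. (\<Sum>x\<leftarrow>a # as. min x t) = (\<Sum>y\<leftarrow>b # bs. min y t)" for a b :: real and as bs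
  proof
    assume "a < b"
    have "(\<Sum>x\<leftarrow>a # as. min x b) < b + (\<Sum>x\<leftarrow>as. b)"
      using \<open>a < b\<close> sum_list_mono[of as "\<lambda>x. min x b" "\<lambda>_. b"] by simp
    also have "(\<Sum>x\<leftarrow>as. b) = (\<Sum>y\<leftarrow>bs. b)" using len by (simp add: sum_list_triv)
    also have "\<dots> = (\<Sum>y\<leftarrow>bs. min y b)"
      using sorted by (intro arg_cong[of _ _ sum_list] map_cong) auto
    finally show False using eq[of b] by simp
  qed
  have "x = y"
    using *[of y ys xs x] *[of x xs ys y] Cons.prems Cons.hyps by (simp add: not_less antisym)
  moreover from this have "xs = ys" using Cons.prems by (intro Cons.IH) simp_all
  ultimately show ?case by simp
qed simp

text \<open>If the partial sums of the nondecreasing sequence \<open>\<sigma>\<close> are the valuations of the coefficients,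
  counted from the leading one, then \<open>\<sigma>\<close> is the sequence of slopes, and the minimum is attained after the
  slopes that are at most \<open>t\<close>.\<close>

lemma gauss_eq_of_coeff_vals:
  fixes h :: "'p :: prime_card padic poly"
  assumes sorted: "sorted \<sigma>" and deg: "degree h = length \<sigma>"
    and val: "\<And>i. i \<le> length \<sigma> \<Longrightarrow> padic_val (coeff h (length \<sigma> - i)) = ereal (sum_list (take i \<sigma>))"
  shows "gauss_eq t (\<Sum>x\<leftarrow>\<sigma>. min x t) h"
proof -
  define r where "r = length \<sigma>"
  have split: "(\<Sum>x\<leftarrow>\<sigma>. min x t) = (\<Sum>x\<leftarrow>take i \<sigma>. min x t) + (\<Sum>x\<leftarrow>drop i \<sigma>. min x t)" for i
    by (metis append_take_drop_id map_append sum_list_append)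
  have drop_sum: "(\<Sum>x\<leftarrow>drop i \<sigma>. t) = real (r - i) * t" for i
    by (simp add: sum_list_triv r_def)
  have "gauss_ge t (\<Sum>x\<leftarrow>\<sigma>. min x t) h"
    unfolding gauss_ge_def
  proof
    fix j show "ereal ((\<Sum>x\<leftarrow>\<sigma>. min x t) - real j * t) \<le> padic_val (coeff h j)"
    proof (cases "j \<le> r")
      case True
      define i where "i = r - j"
      have j: "j = r - i" "i \<le> r" using True by (auto simp: i_def)
      have "(\<Sum>x\<leftarrow>take i \<sigma>. min x t) \<le> sum_list (take i \<sigma>)"
        using sum_list_mono[of "take i \<sigma>" "\<lambda>x. min x t" "\<lambda>x. x"] by simp
      moreover have "(\<Sum>x\<leftarrow>drop i \<sigma>. min x t) \<le> real j * t"
        using sum_list_mono[of "drop i \<sigma>" "\<lambda>x. min x t" "\<lambda>x. t"] drop_sum[of i] by (simp add: j(1))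
      ultimately show ?thesis using val[of i] j split[of i] by (simp add: r_def)
    qed (simp add: coeff_eq_0 deg r_def)
  qed
  moreover have "\<exists>j. padic_val (coeff h j) = ereal ((\<Sum>x\<leftarrow>\<sigma>. min x t) - real j * t)"
  proof -
    define i where "i = length (takeWhile (\<lambda>x. x \<le> t) \<sigma>)"
    have i: "i \<le> r" by (simp add: i_def r_def length_takeWhile_le)
    have "(\<Sum>x\<leftarrow>take i \<sigma>. min x t) = sum_list (take i \<sigma>)"
    proof -
      have "map (\<lambda>x. min x t) (take i \<sigma>) = map (\<lambda>x. x) (take i \<sigma>)"
        by (intro map_cong) (auto simp: i_def takeWhile_eq_take[symmetric] dest: set_takeWhileD)
      then show ?thesis by simp
    qed
    moreover have "(\<Sum>x\<leftarrow>drop i \<sigma>. min x t) = real (r - i) * t"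
    proof -
      have "t < x" if "x \<in> set (drop i \<sigma>)" for x
      proof -
        from that obtain l where l: "l < length \<sigma> - i" "x = \<sigma> ! (i + l)"
          by (auto simp: in_set_conv_nth)
        then have "\<not> \<sigma> ! i \<le> t" unfolding i_def by (intro nth_length_takeWhile) simp
        moreover have "\<sigma> ! i \<le> \<sigma> ! (i + l)" using sorted l by (intro sorted_nth_mono) auto
        ultimately show ?thesis using l by simp
      qed
      then have "map (\<lambda>x. min x t) (drop i \<sigma>) = map (\<lambda>x. t) (drop i \<sigma>)"
        by (intro map_cong) (auto simp: min_absorb2 less_imp_le)
      then show ?thesis using drop_sum[of i] by (simp only:)
    qed
    ultimately show ?thesis
      using val[of i] i split[of i] by (intro exI[of _ "r - i"]) (simp add: r_def)
  qed
  ultimately show ?thesis by (simp add: gauss_eq_def)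
qed

text \<open>Both computations of the Gauss valuation, from the coefficients and from the roots, hold for all
  weights \<open>t\<close>, so the slopes are the valuations of the roots.\<close>

theorem newton_slopes_proots:
  fixes h :: "'p :: prime_card padic poly"
  assumes sorted: "sorted \<sigma>" and deg: "degree h = length \<sigma>" and monic: "lead_coeff h = 1"
    and val: "\<And>i. i \<in> {1..length \<sigma>} \<Longrightarrow> padic_val (coeff h (length \<sigma> - i)) = ereal (sum_list (take i \<sigma>))"
  shows "image_mset padic_val_ext (proots (map_poly to_ac h)) = mset (map ereal \<sigma>)"
proof -
  let ?M = "proots (map_poly to_ac h)"
  have val': "padic_val (coeff h (length \<sigma> - i)) = ereal (sum_list (take i \<sigma>))" if "i \<le> length \<sigma>" for i
    using that monic val[of i] by (cases "i = 0") (simp_all add: deg zero_ereal_def)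
  have "coeff h 0 \<noteq> 0" using val'[of "length \<sigma>"] by auto
  note roots = gauss_eq_proots[OF monic this]
  define \<tau> where "\<tau> = sorted_list_of_multiset (image_mset (\<lambda>a. real_of_ereal (padic_val_ext a)) ?M)"
  have mset_\<tau>: "mset \<tau> = image_mset (\<lambda>a. real_of_ereal (padic_val_ext a)) ?M" by (simp add: \<tau>_def)
  have sum_\<tau>: "(\<Sum>x\<leftarrow>\<tau>. min x t) = (\<Sum>a\<in>#?M. min (real_of_ereal (padic_val_ext a)) t)" for t
  proof -
    have "(\<Sum>x\<leftarrow>\<tau>. min x t) = (\<Sum>x\<in>#mset \<tau>. min x t)" by (simp flip: sum_mset_sum_list)
    then show ?thesis by (simp add: mset_\<tau> image_mset.compositionality comp_def)
  qed
  have "\<tau> = \<sigma>"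
  proof (rule sorted_list_eq_if_sum_min_eq)
    have "length \<tau> = size (mset \<tau>)" by simp
    also have "\<dots> = length \<sigma>" unfolding mset_\<tau> by (simp add: size_proots_alg_closed deg)
    finally show "length \<tau> = length \<sigma>" .
    show "(\<Sum>x\<leftarrow>\<tau>. min x t) = (\<Sum>x\<leftarrow>\<sigma>. min x t)" for t
      unfolding sum_\<tau> using roots[of t] gauss_eq_of_coeff_vals[OF sorted deg val', of t]
      by (intro gauss_eq_unique) auto
  qed (use sorted in \<open>simp_all add: \<tau>_def sorted_sorted_list_of_multiset\<close>)
  then have "mset (map ereal \<sigma>) = image_mset (\<lambda>a. ereal (real_of_ereal (padic_val_ext a))) ?M"
    using mset_\<tau> by (simp add: image_mset.compositionality comp_def)
  also have "\<dots> = image_mset padic_val_ext ?M"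
    using roots by (intro image_mset_cong) (simp add: ereal_real')
  finally show ?thesis ..
qed

section \<open>Smith normal form\<close>

text \<open>Unimodularity is stated as a unit determinant, which is immediate for the triangular and
  elementary matrices below and is preserved by products and transposition; the adjugate turns it into
  invertibility over the integers.\<close>

definition unimod_equiv :: "nat \<Rightarrow> int mat \<Rightarrow> int mat \<Rightarrow> bool" where
  "unimod_equiv n A B \<longleftrightarrow> (\<exists>P Q. P \<in> carrier_mat n n \<and> Q \<in> carrier_mat n n \<and>
     det P dvd 1 \<and> det Q dvd 1 \<and> B = P * A * Q)"

lemma unimod_equiv_refl: "A \<in> carrier_mat n n \<Longrightarrow> unimod_equiv n A A"
  unfolding unimod_equiv_def by (intro exI[of _ "1\<^sub>m n"]) auto

lemma unimod_equiv_carrier: "unimod_equiv n A B \<Longrightarrow> A \<in> carrier_mat n n \<Longrightarrow> B \<in> carrier_mat n n"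
  unfolding unimod_equiv_def by auto

lemma unimod_equiv_trans:
  assumes "unimod_equiv n A B" "unimod_equiv n B C" "A \<in> carrier_mat n n"
  shows "unimod_equiv n A C"
proof -
  obtain P Q P' Q' where c: "P \<in> carrier_mat n n" "Q \<in> carrier_mat n n" "P' \<in> carrier_mat n n" "Q' \<in> carrier_mat n n"
    and d: "det P dvd 1" "det Q dvd 1" "det P' dvd 1" "det Q' dvd 1"
    and e: "B = P * A * Q" "C = P' * B * Q'"
    using assms(1,2) unfolding unimod_equiv_def by blast
  have "C = (P' * P) * A * (Q * Q')"
    using c assms(3) by (simp add: e assoc_mult_mat[of _ n n _ n _ n])
  moreover have "det (P' * P) dvd 1" "det (Q * Q') dvd 1"
    using c d by (simp_all add: det_mult[of _ n] abs_mult)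
  ultimately show ?thesis using c unfolding unimod_equiv_def
    by (intro exI[of _ "P' * P"] exI[of _ "Q * Q'"]) auto
qed

lemma unimod_equiv_transpose:
  assumes "unimod_equiv n A B" "A \<in> carrier_mat n n"
  shows "unimod_equiv n (transpose_mat A) (transpose_mat B)"
proof -
  obtain P Q where c: "P \<in> carrier_mat n n" "Q \<in> carrier_mat n n" 
    and d: "det P dvd 1" "det Q dvd 1" and e: "B = P * A * Q"
    using assms(1) unfolding unimod_equiv_def by blast
  have "transpose_mat B = transpose_mat Q * transpose_mat A * transpose_mat P"
    using c assms(2) by (simp add: e transpose_mult[of _ n n _ n] assoc_mult_mat[of _ n n _ n _ n])
  then show ?thesis using c d unfolding unimod_equiv_def
    by (intro exI[of _ "transpose_mat Q"] exI[of _ "transpose_mat P"]) (auto simp: det_transpose)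
qed

lemma unimod_equiv_mult_left:
  assumes "P \<in> carrier_mat n n" "det P dvd 1" "A \<in> carrier_mat n n"
  shows "unimod_equiv n A (P * A)"
  unfolding unimod_equiv_def using assms by (intro exI[of _ P] exI[of _ "1\<^sub>m n"]) auto

lemma unimod_equiv_addrow:
  assumes "A \<in> carrier_mat n n" "k \<noteq> l" "l < n"
  shows "unimod_equiv n A (addrow a k l A)"
  unfolding addrow_mat[OF assms(1,3)] using assms by (intro unimod_equiv_mult_left) (auto simp: det_addrow_mat)

lemma unimod_equiv_swaprows:
  assumes "A \<in> carrier_mat n n" "k < n" "l < n"
  shows "unimod_equiv n A (swaprows k l A)"
proof (cases "k = l")
  case True
  then have "swaprows k l A = A" by (intro eq_matI) auto
  then show ?thesis using unimod_equiv_refl[OF assms(1)] by simp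
next
  case False
  then show ?thesis
    unfolding swaprows_mat[OF assms] using assms by (intro unimod_equiv_mult_left) (auto simp: det_swaprows_mat)
qed

lemma invertible_mat_if_det_unit:
  fixes P :: "int mat"
  assumes P: "P \<in> carrier_mat n n" and unit: "det P dvd 1"
  obtains P' where "P' \<in> carrier_mat n n" "det P' dvd 1" "P * P' = 1\<^sub>m n" "P' * P = 1\<^sub>m n"
proof -
  \<comment> \<open>A unit of \<open>\<int>\<close> is its own inverse, so \<open>det P\<close> times the adjugate inverts \<open>P\<close>.\<close>
  have sq: "det P * det P = 1" using unit by (auto simp: abs_mult zdvd1_eq abs_if split: if_splits)
  define P' where "P' = det P \<cdot>\<^sub>m adj_mat P"
  note adj = adj_mat[OF P]
  have c: "P' \<in> carrier_mat n n" using adj(1) by (simp add: P'_def)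
  have PP': "P * P' = 1\<^sub>m n"
    unfolding P'_def mult_smult_distrib[OF P adj(1)] adj(2) by (rule eq_matI) (auto simp: sq)
  moreover have "P' * P = 1\<^sub>m n"
    unfolding P'_def mult_smult_assoc_mat[OF adj(1) P] adj(3) by (rule eq_matI) (auto simp: sq)
  moreover have "det P * det P' = 1" using PP' det_mult[OF P c] by simp
  then have "det P' dvd 1" by (metis dvd_triv_right)
  ultimately show ?thesis using c that by blast
qed

lemma unimod_equiv_sym:
  assumes "unimod_equiv n A B" "A \<in> carrier_mat n n"
  shows "unimod_equiv n B A"
proof -
  obtain P Q where c: "P \<in> carrier_mat n n" "Q \<in> carrier_mat n n" 
    and d: "det P dvd 1" "det Q dvd 1" and e: "B = P * A * Q"
    using assms(1) unfolding unimod_equiv_def by blast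
  obtain P' where P': "P' \<in> carrier_mat n n" "det P' dvd 1" "P * P' = 1\<^sub>m n" "P' * P = 1\<^sub>m n"
    using c(1) d(1) by (rule invertible_mat_if_det_unit)
  obtain Q' where Q': "Q' \<in> carrier_mat n n" "det Q' dvd 1" "Q * Q' = 1\<^sub>m n" "Q' * Q = 1\<^sub>m n"
    using c(2) d(2) by (rule invertible_mat_if_det_unit)
  have "P' * B * Q' = (P' * P) * A * (Q * Q')"
    using c P'(1) Q'(1) assms(2) by (simp add: e assoc_mult_mat[of _ n n _ n _ n])
  also have "\<dots> = A" using P' Q' assms(2) by simp
  finally show ?thesis unfolding unimod_equiv_def using P' Q' by metis
qed

text \<open>Divisibility of all entries survives unimodular changes. This makes each invariant factor
  divide the ones found after it.\<close>

lemma unimod_equiv_dvd_entries: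
  assumes "unimod_equiv n A B" "A \<in> carrier_mat n n"
    and "\<And>i j. i < n \<Longrightarrow> j < n \<Longrightarrow> d dvd A $$ (i, j)" and "i < n" "j < n"
  shows "d dvd B $$ (i, j)"
proof -
  obtain P Q where c: "P \<in> carrier_mat n n" "Q \<in> carrier_mat n n" and e: "B = P * A * Q"
    using assms(1) unfolding unimod_equiv_def by blast
  define M where "M = P * A"
  have M: "M \<in> carrier_mat n n" using c assms(2) by (simp add: M_def)
  have "d dvd M $$ (i, k)" if "k < n" for k
    using c assms that by (auto simp: M_def scalar_prod_def intro!: dvd_sum dvd_mult)
  then show ?thesis
    using c M assms(4,5) unfolding e M_def[symmetric] by (auto simp: scalar_prod_def intro!: dvd_sum dvd_mult2)
qed

lemma unimod_equiv_clear_column: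
  assumes A: "A \<in> carrier_mat (Suc n) (Suc n)"
    and dvd: "\<And>i. i < Suc n \<Longrightarrow> A $$ (0, 0) dvd A $$ (i, 0)"
  obtains B where "unimod_equiv (Suc n) A B" "\<And>j. j < Suc n \<Longrightarrow> B $$ (0, j) = A $$ (0, j)"
    "\<And>i. 0 < i \<Longrightarrow> i < Suc n \<Longrightarrow> B $$ (i, 0) = 0"
proof -
  define P where "P = mat (Suc n) (Suc n) (\<lambda>(i, j). if i = j then 1 else if j = 0 then - (A $$ (i, 0) div A $$ (0, 0)) else 0)"
  have P: "P \<in> carrier_mat (Suc n) (Suc n)" by (simp add: P_def)
  have "det P = prod_list (diag_mat P)"
    by (rule det_lower_triangular[OF _ P]) (auto simp: P_def)
  also have "diag_mat P = map (\<lambda>_. 1) [0..<Suc n]"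
    unfolding diag_mat_def using P by (intro map_cong) (auto simp: P_def)
  also have "prod_list (map (\<lambda>_. 1 :: int) [0..<Suc n]) = 1" by (induction n) auto
  finally have "det P dvd 1" by simp
  have entry: "(P * A) $$ (i, j) = (if i = 0 then A $$ (0, j) else A $$ (i, j) - A $$ (i, 0) div A $$ (0, 0) * A $$ (0, j))"
    if "i < Suc n" "j < Suc n" for i j
  proof -
    have "(P * A) $$ (i, j) = (\<Sum>k<Suc n. (if i = k then 1 else if k = 0 then - (A $$ (i, 0) div A $$ (0, 0)) else 0) * A $$ (k, j))"
      using that A by (auto simp: P_def scalar_prod_def lessThan_atLeast0 intro!: sum.cong)
    also have "\<dots> = (\<Sum>k<Suc n. (if k = i then A $$ (k, j) else 0) + (if k = 0 then if i = 0 then 0 else - (A $$ (i, 0) div A $$ (0, 0)) * A $$ (k, j) else 0))"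
      by (intro sum.cong) auto
    also have "\<dots> = (if i = 0 then A $$ (0, j) else A $$ (i, j) - A $$ (i, 0) div A $$ (0, 0) * A $$ (0, j))"
      using that unfolding sum.distrib by (simp add: sum.delta del: sum.lessThan_Suc)
    finally show ?thesis .
  qed
  show ?thesis
  proof (rule that[of "P * A"])
    show "unimod_equiv (Suc n) A (P * A)" by (intro unimod_equiv_mult_left P A \<open>det P dvd 1\<close>)
    show "(P * A) $$ (i, 0) = 0" if "0 < i" "i < Suc n" for i
      using that entry[of i 0] dvd[of i] by simp
  qed (simp add: entry)
qed

definition corner_block :: "nat \<Rightarrow> int \<Rightarrow> int mat \<Rightarrow> int mat" where
  "corner_block n a M = four_block_mat (mat 1 1 (\<lambda>_. a)) (0\<^sub>m 1 n) (0\<^sub>m n 1) M"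

lemma corner_block_props:
  assumes "D \<in> carrier_mat n n" "P \<in> carrier_mat n n" "Q \<in> carrier_mat n n"
  shows "corner_block n 1 P * corner_block n a D * corner_block n 1 Q = corner_block n a (P * D * Q)" and "corner_block n a D \<in> carrier_mat (Suc n) (Suc n)"
    "det (corner_block n 1 P) = det P"
proof -
  have one: "mat 1 1 (\<lambda>_. 1 :: int) = 1\<^sub>m 1" by (rule eq_matI) auto
  show "corner_block n a D \<in> carrier_mat (Suc n) (Suc n)"
    unfolding corner_block_def using four_block_carrier_mat[of "mat 1 1 (\<lambda>_. a)" 1 1 D n n] assms(1) by simp
  show "det (corner_block n 1 P) = det P"
    unfolding corner_block_def one by (subst det_four_block_mat_lower_left_zero[of _ 1 _ n]) (use assms in auto)
  have prod: "corner_block n x M * corner_block n y N = corner_block n (x * y) (M * N)" if "M \<in> carrier_mat n n" "N \<in> carrier_mat n n" for x y M N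
  proof -
    have xy: "mat 1 1 (\<lambda>_. x) * mat 1 1 (\<lambda>_. y) = mat 1 1 (\<lambda>_. x * y)"
      by (rule eq_matI) (auto simp: scalar_prod_def)
    show ?thesis
      unfolding corner_block_def using that
      by (subst mult_four_block_mat[of _ 1 1 _ n _ n _ _ 1 _ n]) (simp_all add: xy[simplified])
  qed
  show "corner_block n 1 P * corner_block n a D * corner_block n 1 Q = corner_block n a (P * D * Q)"
    by (simp only: prod[OF assms(2,1)] prod[OF mult_carrier_mat[OF assms(2,1)] assms(3)] mult_1 mult_1_right)
qed

text \<open>Among all nonzero entries of all matrices equivalent to \<open>A\<close>, let \<open>d\<close> have the least absolute
  value, and move it to the corner.  It divides the first row and column, since a remainder would be a
  smaller nonzero entry of an equivalent matrix; so they can be cleared.  It also divides the rest,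
  since any row can be added to the first one.  The remaining block is treated by induction.\<close>

theorem smith_normal_form_exists:
  fixes A :: "int mat"
  assumes "A \<in> carrier_mat n n"
  shows "\<exists>s. unimod_equiv n A (mat_diag n (\<lambda>i. if i < length s then s ! i else 0)) \<and>
    length s \<le> n \<and> 0 \<notin> set s \<and> sorted_wrt (dvd) s"
  using assms
proof (induction n arbitrary: A)
  case 0
  then have "mat_diag 0 (\<lambda>i. if i < length [] then [] ! i else 0) = A"
    by (intro eq_matI) (auto simp: mat_diag_def)
  then show ?case using unimod_equiv_refl[OF 0] by (intro exI[of _ "[]"]) simp
next
  case (Suc n)
  let ?N = "Suc n"
  note A = Suc.prems
  show ?case
  proof (cases "A = 0\<^sub>m ?N ?N")
    case True
    then have "mat_diag ?N (\<lambda>i. if i < length [] then [] ! i else 0) = A"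
      by (intro eq_matI) (auto simp: mat_diag_def)
    then show ?thesis using unimod_equiv_refl[OF A] by (intro exI[of _ "[]"]) simp
  next
    case False
    define S where "S = {k. \<exists>B i j. unimod_equiv ?N A B \<and> i < ?N \<and> j < ?N \<and> B $$ (i, j) \<noteq> 0 \<and> k = nat \<bar>B $$ (i, j)\<bar>}"
    have "S \<noteq> {}"
    proof -
      obtain i j where "i < ?N" "j < ?N" "A $$ (i, j) \<noteq> 0"
        using False A by (metis carrier_matD eq_matI index_zero_mat)
      then show ?thesis using unimod_equiv_refl[OF A] by (auto simp: S_def)
    qed
    define m where "m = (LEAST k. k \<in> S)"
    have "m \<in> S" using \<open>S \<noteq> {}\<close> unfolding m_def by (metis LeastI ex_in_conv)
    have least: "m \<le> nat \<bar>B $$ (i, j)\<bar>" if "unimod_equiv ?N A B" "i < ?N" "j < ?N" "B $$ (i, j) \<noteq> 0" for B i j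
      unfolding m_def by (rule Least_le) (use that in \<open>auto simp: S_def\<close>)
    obtain B0 i0 j0 where B0: "unimod_equiv ?N A B0" "i0 < ?N" "j0 < ?N" "B0 $$ (i0, j0) \<noteq> 0" "m = nat \<bar>B0 $$ (i0, j0)\<bar>"
      using \<open>m \<in> S\<close> by (auto simp: S_def)
    have trans: "unimod_equiv ?N A C" if "unimod_equiv ?N A B" "unimod_equiv ?N B C" for B C
      using that A by (rule unimod_equiv_trans)
    have carr: "B \<in> carrier_mat ?N ?N" if "unimod_equiv ?N A B" for B
      using that A by (rule unimod_equiv_carrier)
    have T: "unimod_equiv ?N A (transpose_mat B)" if "unimod_equiv ?N (transpose_mat A) B" for B
      using that A by (metis transpose_carrier_mat transpose_transpose unimod_equiv_transpose)
    have swap: "\<exists>C. unimod_equiv ?N A C \<and> C $$ (0, 0) = B0 $$ (i0, j0)"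
    proof -
      define B1 where "B1 = swaprows 0 i0 B0"
      have B1: "unimod_equiv ?N A B1" unfolding B1_def
        using B0 by (intro trans[OF B0(1)] unimod_equiv_swaprows[OF carr[OF B0(1)]]) auto
      have e1: "B1 $$ (0, j0) = B0 $$ (i0, j0)" using B0 carr[OF B0(1)] by (simp add: B1_def)
      define B2 where "B2 = swaprows 0 j0 (transpose_mat B1)"
      have "unimod_equiv ?N (transpose_mat B1) B2"
        unfolding B2_def using carr[OF B1] B0 by (intro unimod_equiv_swaprows) auto
      then have "unimod_equiv ?N B1 (transpose_mat B2)"
        using unimod_equiv_transpose[of ?N "transpose_mat B1" B2] carr[OF B1] by simp
      moreover have "transpose_mat B2 $$ (0, 0) = B0 $$ (i0, j0)"
        using carr[OF B1] B0 e1 by (simp add: B2_def)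
      ultimately show ?thesis using trans[OF B1] by blast
    qed
    then obtain B where B: "unimod_equiv ?N A B" "B $$ (0, 0) = B0 $$ (i0, j0)" by blast
    define d where "d = B0 $$ (i0, j0)"
    have d: "d \<noteq> 0" "m = nat \<bar>d\<bar>" using B0 by (simp_all add: d_def)
    \<comment> \<open>The disjunction lets the same argument serve for rows: it is applied to a matrix or to its transpose.\<close>
    have col_dvd: "d dvd C $$ (i, 0)" if C: "unimod_equiv ?N A C \<or> unimod_equiv ?N A (transpose_mat C)" "C \<in> carrier_mat ?N ?N" "C $$ (0, 0) = d" and i: "i < ?N" for C i
    proof (cases "i = 0")
      case False
      define E where "E = addrow (- (C $$ (i, 0) div d)) i 0 C"
      have CE: "unimod_equiv ?N C E" unfolding E_def using C False by (intro unimod_equiv_addrow) auto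
      have E: "E \<in> carrier_mat ?N ?N" using CE C(2) by (rule unimod_equiv_carrier)
      have "E $$ (i, 0) = C $$ (i, 0) - C $$ (i, 0) div d * d" using C i False by (simp add: E_def)
      then have r: "E $$ (i, 0) = C $$ (i, 0) mod d" by (simp add: minus_div_mult_eq_mod)
      have "E $$ (i, 0) = 0"
      proof (rule ccontr)
        assume nz: "E $$ (i, 0) \<noteq> 0"
        have "m \<le> nat \<bar>E $$ (i, 0)\<bar>"
        proof (cases "unimod_equiv ?N A C")
          case True
          then show ?thesis using least[OF trans[OF True CE], of i 0] i nz by simp
        next
          case False
          then have "unimod_equiv ?N A (transpose_mat C)" using C by blast
          then have "unimod_equiv ?N A (transpose_mat E)"
            using unimod_equiv_transpose[OF CE C(2)] by (rule trans)
          from least[OF this, of 0 i] show ?thesis using i nz E by simp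
        qed
        moreover have "\<bar>C $$ (i, 0) mod d\<bar> < \<bar>d\<bar>" using d(1) by (rule abs_mod_less)
        ultimately show False using d r by simp
      qed
      then show ?thesis using r by (simp add: dvd_eq_mod_eq_0)
    qed (use C in simp)
    obtain C where C: "unimod_equiv ?N B C" "\<And>j. j < ?N \<Longrightarrow> C $$ (0, j) = B $$ (0, j)"
      "\<And>i. 0 < i \<Longrightarrow> i < ?N \<Longrightarrow> C $$ (i, 0) = 0"
      by (rule unimod_equiv_clear_column[OF carr[OF B(1)]])
        (use col_dvd[of B] B carr[OF B(1)] in \<open>auto simp: d_def\<close>)
    have AC: "unimod_equiv ?N A C" by (rule trans[OF B(1) C(1)])
    have C00: "C $$ (0, 0) = d" using C(2)[of 0] B(2) by (simp add: d_def)
    have CT: "transpose_mat C \<in> carrier_mat ?N ?N" using carr[OF AC] by simp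
    obtain E where E: "unimod_equiv ?N (transpose_mat C) E" "\<And>j. j < ?N \<Longrightarrow> E $$ (0, j) = transpose_mat C $$ (0, j)"
      "\<And>i. 0 < i \<Longrightarrow> i < ?N \<Longrightarrow> E $$ (i, 0) = 0"
      by (rule unimod_equiv_clear_column[OF CT])
        (use col_dvd[of "transpose_mat C"] AC CT C00 carr[OF AC] in auto)
    define F where "F = transpose_mat E"
    have Ec: "E \<in> carrier_mat ?N ?N" using E(1) CT by (rule unimod_equiv_carrier)
    have CF: "unimod_equiv ?N C F"
      using unimod_equiv_transpose[OF E(1) CT] by (simp add: F_def)
    have AF: "unimod_equiv ?N A F" by (rule trans[OF AC CF])
    have Fc: "F \<in> carrier_mat ?N ?N" by (rule carr[OF AF])
    have F: "F $$ (0, 0) = d" "\<And>i. 0 < i \<Longrightarrow> i < ?N \<Longrightarrow> F $$ (i, 0) = 0" "\<And>i. 0 < i \<Longrightarrow> i < ?N \<Longrightarrow> F $$ (0, i) = 0"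
      using E(2,3) C(3) C00 Ec carr[OF AC] by (simp_all add: F_def)
    have F_dvd: "d dvd F $$ (i, j)" if ij: "0 < i" "i < ?N" "j < ?N" for i j
    proof -
      \<comment> \<open>The first column of \<open>F\<close> is zero below the corner, so the addition keeps \<open>d\<close> in the corner.\<close>
      define G where "G = addrow 1 0 i F"
      have FG: "unimod_equiv ?N F G" unfolding G_def using Fc ij by (intro unimod_equiv_addrow) auto
      have AG: "unimod_equiv ?N A G" by (rule trans[OF AF FG])
      have G: "G $$ (0, 0) = d" using Fc ij F by (simp add: G_def)
      have "d dvd transpose_mat G $$ (j, 0)"
        using AG carr[OF AG] G ij by (intro col_dvd) auto
      then have "d dvd G $$ (0, j)" using carr[OF AG] ij by simp
      moreover have "G $$ (0, j) = F $$ (i, j) + F $$ (0, j)" using Fc ij by (simp add: G_def)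
      moreover have "d dvd F $$ (0, j)" using F ij by (cases "j = 0") auto
      ultimately show ?thesis by (simp add: dvd_add_left_iff)
    qed
    define D where "D = mat n n (\<lambda>(i, j). F $$ (Suc i, Suc j))"
    have Dc: "D \<in> carrier_mat n n" by (simp add: D_def)
    have D_dvd: "d dvd D $$ (i, j)" if "i < n" "j < n" for i j
      using that F_dvd by (simp add: D_def)
    have F_eq: "F = corner_block n d D"
      using Fc F by (intro eq_matI) (auto simp: corner_block_def D_def)
    obtain s where s: "unimod_equiv n D (mat_diag n (\<lambda>i. if i < length s then s ! i else 0))"
      "length s \<le> n" "0 \<notin> set s" "sorted_wrt (dvd) s"
      using Suc.IH[OF Dc] by blast
    then obtain P Q where PQ: "P \<in> carrier_mat n n" "Q \<in> carrier_mat n n" "det P dvd 1" "det Q dvd 1"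
      and diag: "mat_diag n (\<lambda>i. if i < length s then s ! i else 0) = P * D * Q"
      unfolding unimod_equiv_def by blast
    have "unimod_equiv ?N F (corner_block n d (P * D * Q))"
      unfolding unimod_equiv_def
    proof (intro exI conjI)
      show "corner_block n d (P * D * Q) = corner_block n 1 P * F * corner_block n 1 Q"
        unfolding F_eq by (rule corner_block_props(1)[symmetric]) (use Dc PQ in auto)
      show "corner_block n 1 P \<in> carrier_mat ?N ?N" "corner_block n 1 Q \<in> carrier_mat ?N ?N"
        using PQ by (auto intro!: corner_block_props(2))
      show "det (corner_block n 1 P) dvd 1" "det (corner_block n 1 Q) dvd 1"
        using PQ by (simp_all add: corner_block_props(3)[of P n P P] corner_block_props(3)[of Q n Q Q])
    qed
    moreover have "corner_block n d (P * D * Q) = mat_diag ?N (\<lambda>i. if i < length (d # s) then (d # s) ! i else 0)"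
      unfolding diag[symmetric] by (intro eq_matI) (auto simp: corner_block_def mat_diag_def nth_Cons split: nat.splits)
    ultimately have "unimod_equiv ?N A (mat_diag ?N (\<lambda>i. if i < length (d # s) then (d # s) ! i else 0))"
      using trans[OF AF] by simp
    moreover have "d dvd x" if x: "x \<in> set s" for x
    proof -
      obtain i where i: "i < length s" "x = s ! i" using x by (auto simp: in_set_conv_nth)
      have "d dvd mat_diag n (\<lambda>i. if i < length s then s ! i else 0) $$ (i, i)"
        by (rule unimod_equiv_dvd_entries[OF s(1) Dc D_dvd]) (use i s(2) in auto)
      then show ?thesis using i s(2) by (simp add: mat_diag_def)
    qed
    ultimately show ?thesis using s d(1) by (intro exI[of _ "d # s"]) auto
  qed
qed

section \<open>Minors and determinantal divisors\<close>

text \<open>Minors with rows and columns selected by arbitrary functions, possibly with repetitions, are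
  stable under multilinear expansion.  A repetition makes the determinant zero, and a different order
  only changes its sign, so the common divisors are those of the ordinary minors.\<close>

definition minor_dvd :: "int \<Rightarrow> nat \<Rightarrow> nat \<Rightarrow> int mat \<Rightarrow> bool" where
  "minor_dvd d n k A \<longleftrightarrow> (\<forall>f g. f ` {..<k} \<subseteq> {..<n} \<longrightarrow> g ` {..<k} \<subseteq> {..<n} \<longrightarrow>
     d dvd det (mat k k (\<lambda>(i, j). A $$ (f i, g j))))"

lemma minor_dvdD:
  assumes "minor_dvd d n k A" "\<And>i. i < k \<Longrightarrow> f i < n" "\<And>i. i < k \<Longrightarrow> g i < n"
  shows "d dvd det (mat k k (\<lambda>(i, j). A $$ (f i, g j)))"
  using assms unfolding minor_dvd_def by blast

lemma det_mat_eq: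
  "det (mat k k F) = (\<Sum>p | p permutes {0..<k}. signof p * (\<Prod>i = 0..<k. F (i, p i)))"
  for F :: "nat \<times> nat \<Rightarrow> 'a :: comm_ring_1"
proof -
  have "det (mat k k F) = (\<Sum>p | p permutes {0..<k}. signof p * (\<Prod>i = 0..<k. mat k k F $$ (i, p i)))"
    by (rule det_def') simp
  also have "\<dots> = (\<Sum>p | p permutes {0..<k}. signof p * (\<Prod>i = 0..<k. F (i, p i)))"
    by (intro sum.cong arg_cong2[of _ _ _ _ "(*)"] prod.cong) auto
  finally show ?thesis .
qed

text \<open>The rows of \<open>P * A\<close> are combinations of the rows of \<open>A\<close>.  Expanding the determinant in its rows
  writes each minor of \<open>P * A\<close> as a combination of minors of \<open>A\<close>, one for each function \<open>h\<close> that selects a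
  row of \<open>A\<close> for every row of the minor.\<close>

lemma minor_dvd_mult_left:
  assumes P: "P \<in> carrier_mat n n" and A: "A \<in> carrier_mat n n" and dvd: "minor_dvd d n k A"
  shows "minor_dvd d n k (P * A)"
  unfolding minor_dvd_def
proof (intro allI impI)
  fix f g :: "nat \<Rightarrow> nat" assume fg: "f ` {..<k} \<subseteq> {..<n}" "g ` {..<k} \<subseteq> {..<n}"
  let ?H = "{0..<k} \<rightarrow>\<^sub>E {0..<n}"
  have entry: "(P * A) $$ (f i, g j) = (\<Sum>l = 0..<n. P $$ (f i, l) * A $$ (l, g j))"
    if "i < k" "j < k" for i j
  proof -
    have "f i < n" "g j < n" using fg that by auto
    then show ?thesis using P A by (simp add: scalar_prod_def)
  qed
  have "det (mat k k (\<lambda>(i, j). (P * A) $$ (f i, g j))) =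
      (\<Sum>p | p permutes {0..<k}. signof p * (\<Prod>i = 0..<k. \<Sum>l = 0..<n. P $$ (f i, l) * A $$ (l, g (p i))))"
    unfolding det_mat_eq by (intro sum.cong arg_cong2[of _ _ _ _ "(*)"] prod.cong) (auto simp: entry)
  also have "\<dots> = (\<Sum>p | p permutes {0..<k}. \<Sum>h\<in>?H.
      (\<Prod>i = 0..<k. P $$ (f i, h i)) * (signof p * (\<Prod>i = 0..<k. A $$ (h i, g (p i)))))"
    by (subst prod_sum_PiE) (simp_all add: sum_distrib_left prod.distrib ac_simps)
  also have "\<dots> = (\<Sum>h\<in>?H. (\<Prod>i = 0..<k. P $$ (f i, h i)) * det (mat k k (\<lambda>(i, j). A $$ (h i, g j))))"
    by (subst sum.swap) (simp add: sum_distrib_left det_mat_eq)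
  finally have eq: "det (mat k k (\<lambda>(i, j). (P * A) $$ (f i, g j))) = \<dots>" .
  show "d dvd det (mat k k (\<lambda>(i, j). (P * A) $$ (f i, g j)))"
    unfolding eq
  proof (intro dvd_sum dvd_mult minor_dvdD[OF dvd])
    fix h i assume "h \<in> ?H" "i < k"
    then show "h i < n" by (auto simp: PiE_iff)
  qed (use fg in auto)
qed

lemma minor_dvd_transpose:
  assumes A: "A \<in> carrier_mat n n" and dvd: "minor_dvd d n k A"
  shows "minor_dvd d n k (transpose_mat A)"
  unfolding minor_dvd_def
proof (intro allI impI)
  fix f g :: "nat \<Rightarrow> nat" assume fg: "f ` {..<k} \<subseteq> {..<n}" "g ` {..<k} \<subseteq> {..<n}"
  let ?M = "mat k k (\<lambda>(i, j). A $$ (g i, f j))"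
  have lt: "f i < n" "g i < n" if "i < k" for i using fg that by auto
  have "mat k k (\<lambda>(i, j). transpose_mat A $$ (f i, g j)) = transpose_mat ?M"
    using A by (intro eq_matI) (auto simp: lt)
  then have "det (mat k k (\<lambda>(i, j). transpose_mat A $$ (f i, g j))) = det ?M"
    by (simp add: det_transpose[of _ k])
  then show "d dvd det (mat k k (\<lambda>(i, j). transpose_mat A $$ (f i, g j)))"
    using minor_dvdD[OF dvd, of g f] fg by auto
qed

lemma minor_dvd_unimod_equiv:
  assumes AB: "unimod_equiv n A B" and A: "A \<in> carrier_mat n n" and dvd: "minor_dvd d n k A"
  shows "minor_dvd d n k B"
proof -
  obtain P Q where c: "P \<in> carrier_mat n n" "Q \<in> carrier_mat n n" and B: "B = P * A * Q"
    using AB unfolding unimod_equiv_def by blast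
  have PA: "P * A \<in> carrier_mat n n" using c A by simp
  have "minor_dvd d n k (transpose_mat Q * transpose_mat (P * A))"
    by (intro minor_dvd_mult_left minor_dvd_transpose[OF PA] dvd) (use c A PA in auto)
  then have "minor_dvd d n k (transpose_mat (transpose_mat Q * transpose_mat (P * A)))"
    by (rule minor_dvd_transpose[rotated]) (use c A in auto)
  also have "transpose_mat (transpose_mat Q * transpose_mat (P * A)) = B"
    unfolding B using c PA by (subst transpose_mult[of _ n n _ n]) auto
  finally show ?thesis .
qed

lemma det_eq_0_if_rows_repeat:
  assumes "\<not> inj_on f {..<k}"
  shows "det (mat k k (\<lambda>(i, j). F (f i) j) :: 'a :: comm_ring_1 mat) = 0"
proof -
  obtain i j where "i < k" "j < k" "i \<noteq> j" "f i = f j" using assms by (auto simp: inj_on_def)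
  then show ?thesis by (intro det_identical_rows[of _ k i j]) (auto intro!: eq_vecI)
qed

lemma inj_on_eq_pick_permutation:
  fixes f :: "nat \<Rightarrow> nat"
  assumes inj: "inj_on f {..<k}"
  obtains p where "p permutes {0..<k}" "\<And>i. i < k \<Longrightarrow> f i = pick (f ` {..<k}) (p i)"
proof -
  let ?I = "f ` {..<k}"
  define p where "p i = (if i < k then card {a \<in> ?I. a < f i} else i)" for i
  have card: "card ?I = k" using inj by (simp add: card_image)
  have pick: "f i = pick ?I (p i)" if "i < k" for i
    using that pick_card_in_set[of "f i" ?I] by (simp add: p_def)
  have "p permutes {0..<k}"
  proof (rule inj_imp_permutes)
    show "inj_on p {0..<k}"
    proof (rule inj_onI)
      fix i j assume ij: "i \<in> {0..<k}" "j \<in> {0..<k}" "p i = p j"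
      then have "f i = f j" using pick[of i] pick[of j] by simp
      then show "i = j" using inj ij by (auto simp: inj_on_def)
    qed
    show "p i \<in> {0..<k}" if "i \<in> {0..<k}" for i
    proof -
      have "card {a \<in> ?I. a < f i} < card ?I"
        by (rule psubset_card_mono) (use that in auto)
      then show ?thesis using that card by (simp add: p_def)
    qed
  qed (auto simp: p_def)
  then show ?thesis using pick by (rule that)
qed

lemma minor_dvd_if_submatrix:
  assumes A: "A \<in> carrier_mat n n"
    and dvd: "\<And>I J. I \<subseteq> {..<n} \<Longrightarrow> J \<subseteq> {..<n} \<Longrightarrow> card I = k \<Longrightarrow> card J = k \<Longrightarrow> d dvd det (submatrix A I J)"
  shows "minor_dvd d n k A"
  unfolding minor_dvd_def
proof (intro allI impI)
  fix f g :: "nat \<Rightarrow> nat" assume fg: "f ` {..<k} \<subseteq> {..<n}" "g ` {..<k} \<subseteq> {..<n}"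
  let ?M = "mat k k (\<lambda>(i, j). A $$ (f i, g j))"
  let ?I = "f ` {..<k}" and ?J = "g ` {..<k}"
  show "d dvd det ?M"
  proof (cases "inj_on f {..<k} \<and> inj_on g {..<k}")
    case True
    obtain p where p: "p permutes {0..<k}" "\<And>i. i < k \<Longrightarrow> f i = pick ?I (p i)"
      using True inj_on_eq_pick_permutation[of f k] by blast
    obtain q where q: "q permutes {0..<k}" "\<And>i. i < k \<Longrightarrow> g i = pick ?J (q i)"
      using True inj_on_eq_pick_permutation[of g k] by blast
    have pk: "p i < k" "q i < k" if "i < k" for i
      using that permutes_in_image[OF p(1), of i] permutes_in_image[OF q(1), of i] by auto
    define S where "S = submatrix A ?I ?J"
    have card: "card ?I = k" "card ?J = k" using True by (simp_all add: card_image)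
    have IJ: "{i. i < n \<and> i \<in> ?I} = ?I" "{i. i < n \<and> i \<in> ?J} = ?J" using fg by auto
    have S: "S \<in> carrier_mat k k" using A card IJ by (auto simp: S_def dim_submatrix)
    have S_entry: "S $$ (i, j) = A $$ (pick ?I i, pick ?J j)" if "i < k" "j < k" for i j
      unfolding S_def by (rule submatrix_index) (use A card IJ that in auto)
    define N where "N = mat k k (\<lambda>(i, j). S $$ (p i, j))"
    have N: "N \<in> carrier_mat k k" by (simp add: N_def)
    have "transpose_mat ?M = mat k k (\<lambda>(j, i). transpose_mat N $$ (q j, i))"
      using A pk p(2) q(2) S by (intro eq_matI) (auto simp: N_def S_entry)
    then have "det (transpose_mat ?M) = signof q * det (transpose_mat N)"
      using det_permute_rows[OF transpose_carrier_mat[THEN iffD2, OF N] q(1)] by simp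
    then have "det ?M = signof q * det N"
      using det_transpose[OF N] by (simp add: det_transpose[of _ k])
    also have "det N = signof p * det S" unfolding N_def by (rule det_permute_rows[OF S p(1)])
    finally show ?thesis unfolding S_def
      using dvd[OF fg card] by simp
  next
    case False
    have "det ?M = 0"
    proof (cases "inj_on f {..<k}")
      case True
      then have ng: "\<not> inj_on g {..<k}" using False by blast
      have "transpose_mat ?M = mat k k (\<lambda>(i, j). A $$ (f j, g i))" by (intro eq_matI) auto
      then have "det (transpose_mat ?M) = 0"
        using det_eq_0_if_rows_repeat[OF ng, of "\<lambda>x j. A $$ (f j, x)"] by simp
      then show ?thesis by (simp add: det_transpose[of _ k])
    qed (rule det_eq_0_if_rows_repeat[of f k "\<lambda>x j. A $$ (x, g j)"])
    then show ?thesis by simp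
  qed
qed

lemma submatrix_dvd_if_minor:
  assumes A: "A \<in> carrier_mat n n" and dvd: "minor_dvd d n k A"
    and IJ: "I \<subseteq> {..<n}" "J \<subseteq> {..<n}" "card I = k" "card J = k"
  shows "d dvd det (submatrix A I J)"
proof -
  have eq: "{i. i < n \<and> i \<in> I} = I" "{i. i < n \<and> i \<in> J} = J" using IJ by auto
  have "submatrix A I J = mat k k (\<lambda>(i, j). A $$ (pick I i, pick J j))"
    using A IJ eq by (simp add: submatrix_def)
  moreover have "pick I i < n" "pick J i < n" if "i < k" for i
    using that IJ pick_in_set_le[of i I] pick_in_set_le[of i J] by auto
  ultimately show ?thesis using minor_dvdD[OF dvd, of "pick I" "pick J"] by simp
qed

text \<open>The \<open>i\<close>-th smallest element of \<open>S\<close> is at least \<open>i\<close>; peeling off the largest element turns this into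
  an induction.\<close>

lemma prod_dvd_prod_of_card:
  fixes s :: "nat \<Rightarrow> int"
  assumes mono: "\<And>i j. i \<le> j \<Longrightarrow> s i dvd s j" and "finite S"
  shows "(\<Prod>i<card S. s i) dvd (\<Prod>i\<in>S. s i)"
  using assms(2)
proof (induction "card S" arbitrary: S)
  case (Suc k)
  let ?m = "Max S"
  have S: "S \<noteq> {}" using Suc.hyps(2) by auto
  have m: "?m \<in> S" using Suc.prems S by (rule Max_in)
  have "S \<subseteq> {..?m}" using Suc.prems by auto
  then have "card S \<le> Suc ?m" using card_mono[of "{..?m}" S] by simp
  then have "k \<le> ?m" using Suc.hyps(2) by simp
  have "card (S - {?m}) = k" using Suc.hyps(2) m Suc.prems by simp
  then have "(\<Prod>i<k. s i) dvd (\<Prod>i\<in>S - {?m}. s i)" using Suc.hyps(1)[of "S - {?m}"] Suc.prems by simp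
  then have "(\<Prod>i<k. s i) * s k dvd (\<Prod>i\<in>S - {?m}. s i) * s ?m"
    using mono[OF \<open>k \<le> ?m\<close>] by (rule mult_dvd_mono)
  also have "\<dots> = (\<Prod>i\<in>S. s i)" using prod.remove[OF Suc.prems m, of s] by (simp add: mult.commute)
  finally show ?case by (simp flip: Suc.hyps(2))
qed simp

text \<open>In the Leibniz expansion of a minor of a diagonal matrix, a nonzero term is the product of the
  diagonal entries in the selected rows.\<close>

lemma minor_dvd_diag:
  assumes mono: "\<And>i j. i \<le> j \<Longrightarrow> s i dvd s j"
  shows "minor_dvd (\<Prod>i<k. s i) n k (mat_diag n s)"
  unfolding minor_dvd_def
proof (intro allI impI)
  fix f g :: "nat \<Rightarrow> nat" assume fg: "f ` {..<k} \<subseteq> {..<n}" "g ` {..<k} \<subseteq> {..<n}"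
  let ?M = "mat k k (\<lambda>(i, j). mat_diag n s $$ (f i, g j))"
  show "(\<Prod>i<k. s i) dvd det ?M"
  proof (cases "inj_on f {..<k}")
    case True
    then have card: "card (f ` {..<k}) = k" by (simp add: card_image)
    have "(\<Prod>i<k. s i) dvd (\<Prod>i\<in>f ` {..<k}. s i)"
      using prod_dvd_prod_of_card[where s = s and S = "f ` {..<k}", OF mono] by (simp add: card)
    also have "(\<Prod>i\<in>f ` {..<k}. s i) = (\<Prod>i = 0..<k. s (f i))"
      using prod.reindex[OF True, of s] by (simp add: lessThan_atLeast0)
    finally have main: "(\<Prod>i<k. s i) dvd (\<Prod>i = 0..<k. s (f i))" .
    show ?thesis
      unfolding det_mat_eq
    proof (intro dvd_sum dvd_mult)
      fix p assume "p \<in> {p. p permutes {0..<k}}"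
      then have pk: "p i < k" if "i < k" for i using that permutes_in_image[of p "{0..<k}" i] by auto
      have "(\<Prod>i = 0..<k. s (f i)) dvd (\<Prod>i = 0..<k. mat_diag n s $$ (f i, g (p i)))"
      proof (rule prod_dvd_prod)
        fix i assume i: "i \<in> {0..<k}"
        then have "f i < n" "g (p i) < n" using fg pk[of i] by auto
        then show "s (f i) dvd mat_diag n s $$ (f i, g (p i))" by (simp add: mat_diag_def)
      qed
      from dvd_trans[OF main this] show "(\<Prod>i<k. s i) dvd (\<Prod>i = 0..<k. case (i, p i) of (i, j) \<Rightarrow> mat_diag n s $$ (f i, g j))"
        by simp
    qed
  qed (simp add: det_eq_0_if_rows_repeat[of f k "\<lambda>x j. mat_diag n s $$ (x, g j)"])
qed

lemma det_leading_diag: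
  assumes "k \<le> n"
  shows "det (mat k k (\<lambda>(i, j). mat_diag n s $$ (i, j))) = (\<Prod>i<k. s i :: int)"
proof -
  let ?M = "mat k k (\<lambda>(i, j). mat_diag n s $$ (i, j))"
  have "det ?M = prod_list (diag_mat ?M)"
    by (rule det_upper_triangular[of _ k]) (use assms in \<open>auto simp: mat_diag_def\<close>)
  also have "diag_mat ?M = map s [0..<k]"
    unfolding diag_mat_def using assms by (intro map_cong) (auto simp: mat_diag_def)
  finally show ?thesis by (simp add: lessThan_atLeast0 prod.list_conv_set_nth)
qed

text \<open>The diagonal of a Smith normal form as a function; the padding by 0 keeps the divisibility chain.\<close>

definition padded :: "int list \<Rightarrow> nat \<Rightarrow> int" where
  "padded s i = (if i < length s then s ! i else 0)"

lemma padded_dvd: "sorted_wrt (dvd) s \<Longrightarrow> i \<le> j \<Longrightarrow> padded s i dvd padded s j"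
  by (cases "i = j") (auto simp: padded_def sorted_wrt_iff_nth_less)

text \<open>Unimodular equivalence preserves the common divisors of the minors.  For the diagonal matrix, the
  leading minor is the product of the first invariant factors and divides all the others.\<close>

theorem determinantal_divisor_eq:
  assumes A: "A \<in> carrier_mat n n" and AD: "unimod_equiv n A (mat_diag n (padded s))"
    and s: "sorted_wrt (dvd) s" "length s \<le> n" and k: "k \<le> length s"
  shows "\<bar>determinantal_divisor A k\<bar> = \<bar>prod_list (take k s)\<bar>"
proof -
  let ?\<Delta> = "determinantal_divisor A k"
  let ?D = "mat_diag n (padded s)"
  have D: "?D \<in> carrier_mat n n" by simp
  have prod: "(\<Prod>i<k. padded s i) = prod_list (take k s)"
    using k by (simp add: padded_def lessThan_atLeast0 prod.list_conv_set_nth min_def)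
  have \<Delta>: "?\<Delta> = Gcd {det (submatrix A I J) | I J. I \<subseteq> {..<n} \<and> J \<subseteq> {..<n} \<and> card I = k \<and> card J = k}"
    using A by (simp add: determinantal_divisor_def)
  have "minor_dvd ?\<Delta> n k A"
    unfolding \<Delta> by (rule minor_dvd_if_submatrix[OF A]) (blast intro: Gcd_dvd)
  then have "minor_dvd ?\<Delta> n k ?D" by (rule minor_dvd_unimod_equiv[OF AD A])
  then have "?\<Delta> dvd det (mat k k (\<lambda>(i, j). ?D $$ (i, j)))"
    using k s(2) by (intro minor_dvdD[of _ n k _ "\<lambda>i. i" "\<lambda>i. i"]) auto
  then have "?\<Delta> dvd prod_list (take k s)" unfolding det_leading_diag[OF order_trans[OF k s(2)]] prod .
  moreover have "minor_dvd (prod_list (take k s)) n k A"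
    unfolding prod[symmetric]
    by (rule minor_dvd_unimod_equiv[OF unimod_equiv_sym[OF AD A] D minor_dvd_diag[OF padded_dvd[OF s(1)]]])
  then have "prod_list (take k s) dvd ?\<Delta>"
    unfolding \<Delta> by (intro Gcd_greatest) (auto intro: submatrix_dvd_if_minor[OF A])
  ultimately show ?thesis by (rule zdvd_antisym_abs)
qed

section \<open>Rank and characteristic polynomial\<close>

lemma rank_sum_of_rank_one_le:
  fixes U V :: "nat \<Rightarrow> nat \<Rightarrow> 'a :: field"
  shows "vec_space.rank n (mat n n (\<lambda>(i, j). \<Sum>l<k. U i l * V l j)) \<le> k"
proof (induction k)
  case 0
  have "mat n n (\<lambda>(i, j). \<Sum>l<0. U i l * V l j) = 0\<^sub>m n n" by (intro eq_matI) auto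
  then show ?case by (simp only: vec_space.rank_0I)
next
  case (Suc k)
  let ?A = "mat n n (\<lambda>(i, j). \<Sum>l<k. U i l * V l j)" and ?B = "mat n n (\<lambda>(i, j). U i k * V k j)"
  have "mat n n (\<lambda>(i, j). \<Sum>l<Suc k. U i l * V l j) = ?A + ?B" by (intro eq_matI) auto
  moreover have "vec_space.rank n (?A + ?B) \<le> vec_space.rank n ?A + vec_space.rank n ?B"
    by (rule vec_space.rank_subadditive[of _ n n]) auto
  moreover have "vec_space.rank n ?B \<le> 1"
    by (rule vec_space.rank_le_1_product_entries[of _ n n "\<lambda>i. U i k" "\<lambda>j. V k j"]) auto
  ultimately show ?case using Suc.IH by simp
qed

text \<open>Undoing the diagonalization writes \<open>A\<close> as a sum of \<open>length s\<close> matrices of rank at most one.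
  Conversely, if all minors of that size vanished for \<open>A\<close>, that is, if 0 divided them, they would
  vanish for the diagonal matrix as well.\<close>

theorem int_rank_eq:
  assumes A: "A \<in> carrier_mat n n" and AD: "unimod_equiv n A (mat_diag n (padded s))"
    and s: "0 \<notin> set s" "length s \<le> n"
  shows "int_rank A = length s"
proof (rule antisym)
  let ?D = "mat_diag n (padded s)" and ?r = "length s"
  have D: "?D \<in> carrier_mat n n" by simp
  obtain P Q where c: "P \<in> carrier_mat n n" "Q \<in> carrier_mat n n" and e: "A = P * ?D * Q"
    using unimod_equiv_sym[OF AD A] unfolding unimod_equiv_def by blast
  have "A $$ (i, j) = (\<Sum>l<?r. P $$ (i, l) * (s ! l * Q $$ (l, j)))" if "i < n" "j < n" for i j
  proof -
    define M where "M = P * ?D"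
    have M: "M \<in> carrier_mat n n" using c by (simp add: M_def)
    have PD: "M $$ (i, l) = P $$ (i, l) * padded s l" if "l < n" for l
      using that \<open>i < n\<close> c(1) by (simp add: M_def mat_diag_mult_right)
    have "A $$ (i, j) = (\<Sum>l<n. M $$ (i, l) * Q $$ (l, j))"
      unfolding e M_def[symmetric] using that c M by (simp add: scalar_prod_def lessThan_atLeast0)
    also have "\<dots> = (\<Sum>l<n. P $$ (i, l) * padded s l * Q $$ (l, j))" by (simp add: PD)
    also have "\<dots> = (\<Sum>l<?r. P $$ (i, l) * padded s l * Q $$ (l, j))"
      by (rule sum.mono_neutral_right) (use s(2) in \<open>auto simp: padded_def\<close>)
    finally show ?thesis by (simp add: padded_def mult.assoc)
  qed
  then have "map_mat rat_of_int A =
      mat n n (\<lambda>(i, j). \<Sum>l<?r. rat_of_int (P $$ (i, l)) * rat_of_int (s ! l * Q $$ (l, j)))"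
    using A by (intro eq_matI) auto
  then show "int_rank A \<le> ?r"
    using A rank_sum_of_rank_one_le[of n "\<lambda>i l. rat_of_int (P $$ (i, l))" "\<lambda>l j. rat_of_int (s ! l * Q $$ (l, j))" ?r]
    by (simp add: int_rank_def)
  show "?r \<le> int_rank A"
  proof -
    have "\<exists>I J. I \<subseteq> {..<n} \<and> J \<subseteq> {..<n} \<and> card I = ?r \<and> card J = ?r \<and> det (submatrix A I J) \<noteq> 0"
    proof (rule ccontr)
      assume "\<not> ?thesis"
      then have "minor_dvd 0 n ?r A" by (intro minor_dvd_if_submatrix[OF A]) auto
      then have "minor_dvd 0 n ?r ?D" by (rule minor_dvd_unimod_equiv[OF AD A])
      then have "0 dvd det (mat ?r ?r (\<lambda>(i, j). ?D $$ (i, j)))"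
        using s(2) by (intro minor_dvdD[of _ n ?r _ "\<lambda>i. i" "\<lambda>i. i"]) auto
      then have "(\<Prod>i<?r. padded s i) = 0" unfolding det_leading_diag[OF s(2)] by simp
      then show False using s(1) by (auto simp: padded_def in_set_conv_nth)
    qed
    then obtain I J where IJ: "I \<subseteq> {..<n}" "J \<subseteq> {..<n}" "card I = ?r" "card J = ?r" "det (submatrix A I J) \<noteq> 0"
      by blast
    have "submatrix (map_mat rat_of_int A) I J = map_mat rat_of_int (submatrix A I J)"
    proof (rule eq_matI)
      fix i j assume "i < dim_row (map_mat rat_of_int (submatrix A I J))" "j < dim_col (map_mat rat_of_int (submatrix A I J))"
      then have ij: "i < card {i. i < dim_row A \<and> i \<in> I}" "j < card {j. j < dim_col A \<and> j \<in> J}"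
        by (simp_all add: dim_submatrix)
      then have "pick I i < dim_row A" "pick J j < dim_col A" by (simp_all add: pick_le)
      then show "submatrix (map_mat rat_of_int A) I J $$ (i, j) = map_mat rat_of_int (submatrix A I J) $$ (i, j)"
        using ij by (simp add: submatrix_def)
    qed (simp_all add: dim_submatrix)
    then have "det (submatrix (map_mat rat_of_int A) I J) \<noteq> 0" using IJ(5) by simp
    moreover have "{j. j < n \<and> j \<in> J} = J" using IJ(2) by auto
    ultimately show ?thesis
      using vec_space.rank_gt_minor[of "map_mat rat_of_int A" n n I J] A IJ(4) by (simp add: int_rank_def)
  qed
qed

text \<open>If \<open>P A Q = D\<close> is diagonal, then \<open>P (x I - A) Q = x P Q - D\<close>, where all columns after the first
  \<open>length s\<close> are divisible by \<open>x\<close>.  As \<open>P\<close> and \<open>Q\<close> have unit determinants, the corresponding power of \<open>x\<close>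
  divides the characteristic polynomial.\<close>

theorem power_dvd_char_poly:
  assumes A: "A \<in> carrier_mat n n" and AD: "unimod_equiv n A (mat_diag n (padded s))"
    and s: "length s \<le> n"
  shows "monom 1 (n - length s) dvd char_poly A"
proof -
  let ?r = "length s" and ?X = "[:0, 1:] :: int poly"
  interpret C: comm_ring_hom "\<lambda>a :: int. [:a:]" by unfold_locales auto
  let ?C = "map_mat (\<lambda>a :: int. [:a:])"
  obtain P Q where c: "P \<in> carrier_mat n n" "Q \<in> carrier_mat n n" and u: "det P dvd 1" "det Q dvd 1"
    and D: "mat_diag n (padded s) = P * A * Q"
    using AD unfolding unimod_equiv_def by blast
  define D where "D = mat_diag n (padded s)"
  define R where "R = P * Q"
  have Rc: "R \<in> carrier_mat n n" and Dc: "D \<in> carrier_mat n n" using c by (simp_all add: R_def D_def)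
  have K: "char_poly_matrix A = ?X \<cdot>\<^sub>m 1\<^sub>m n + ?C (- A)"
    using A by (intro eq_matI) (auto simp: char_poly_matrix_def)
  have cc: "?C P \<in> carrier_mat n n" "?C Q \<in> carrier_mat n n" "?C (- A) \<in> carrier_mat n n"
    using c A by auto
  have "?C P * char_poly_matrix A = ?X \<cdot>\<^sub>m ?C P + ?C P * ?C (- A)"
    unfolding K using cc
    by (subst mult_add_distrib_mat[of _ n n _ n]) (simp_all add: mult_smult_distrib[of _ n n _ n])
  then have "?C P * char_poly_matrix A * ?C Q = ?X \<cdot>\<^sub>m (?C P * ?C Q) + ?C P * ?C (- A) * ?C Q"
    using cc by (simp add: add_mult_distrib_mat[of _ n n _ _ n] mult_smult_assoc_mat[of _ n n _ n])
  also have "?C P * ?C Q = ?C R" unfolding R_def by (rule C.mat_hom_mult[symmetric]) (use c in auto)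
  also have "?C P * ?C (- A) = ?C (P * (- A))" by (rule C.mat_hom_mult[symmetric]) (use c A in auto)
  also have "?C (P * (- A)) * ?C Q = ?C (P * (- A) * Q)"
    by (rule C.mat_hom_mult[symmetric]) (use c A in auto)
  also have "P * (- A) * Q = - D"
    using c A by (simp add: D_def D)
  finally have prod: "?C P * char_poly_matrix A * ?C Q = ?X \<cdot>\<^sub>m ?C R + ?C (- D)" .
  \<comment> \<open>\<open>N\<close> arises from \<open>x P Q - D\<close> by removing the factor \<open>x\<close> from the last columns, and \<open>E\<close> puts it back.\<close>
  define N where "N = mat n n (\<lambda>(i, l). if l < ?r then ?X * [:R $$ (i, l):] - [:D $$ (i, l):] else [:R $$ (i, l):])"
  define E where "E = mat_diag n (\<lambda>l. if l < ?r then 1 else ?X)"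
  have Nc: "N \<in> carrier_mat n n" and Ec: "E \<in> carrier_mat n n" by (simp_all add: N_def E_def)
  have NE: "?X \<cdot>\<^sub>m ?C R + ?C (- D) = N * E"
    unfolding E_def mat_diag_mult_right[OF Nc] using Rc Dc
    by (intro eq_matI) (auto simp: N_def D_def mat_diag_def padded_def)
  have "det E = prod_list (diag_mat E)"
    by (rule det_upper_triangular[OF _ Ec]) (auto simp: E_def mat_diag_def)
  also have "\<dots> = (\<Prod>l = 0..<n. if l < ?r then 1 else ?X)"
    unfolding diag_mat_def prod.list_conv_set_nth by (intro prod.cong) (auto simp: E_def mat_diag_def)
  also have "\<dots> = (\<Prod>l = ?r..<n. ?X)"
    using s by (intro prod.mono_neutral_cong_right) auto
  also have "\<dots> = monom 1 (n - ?r)" by (simp add: monom_altdef)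
  finally have detE: "det E = monom 1 (n - ?r)" .
  have "det (?C P) * char_poly A * det (?C Q) = det (?C P * char_poly_matrix A * ?C Q)"
    using cc A by (simp add: char_poly_def det_mult[of _ n])
  also have "\<dots> = det N * monom 1 (n - ?r)"
    unfolding prod NE using Nc Ec by (simp add: det_mult[of _ n] detE)
  finally have dvd: "monom 1 (n - ?r) dvd det (?C P) * char_poly A * det (?C Q)" by simp
  have unit: "det (?C P) dvd 1" "det (?C Q) dvd 1" using u by (simp_all add: is_unit_const_poly_iff)
  show ?thesis
    using dvd unfolding dvd_mult_unit_iff[OF unit(2)] dvd_mult_unit_iff'[OF unit(1)] .
qed

section \<open>Finite extensions generated by algebraic elements\<close>

text \<open>Every element of the algebraic closure is algebraic in the sense of the locale-based theory of
  field extensions, whose polynomials are coefficient lists with the leading coefficient first.\<close>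

lemma exists_finite_extension:
  fixes xs :: "'a :: field alg_closure list"
  obtains K where "finite_extension K" "set xs \<subseteq> K"
proof -
  let ?R = "ring_of_type_algebra :: 'a alg_closure ring"
  let ?K = "range to_ac :: 'a alg_closure set"
  interpret R: field ?R by (rule field_from_type_algebra)
  have ops: "carrier ?R = UNIV" "\<zero>\<^bsub>?R\<^esub> = 0" "\<one>\<^bsub>?R\<^esub> = 1" "x \<oplus>\<^bsub>?R\<^esub> y = x + y" "x \<otimes>\<^bsub>?R\<^esub> y = x * y" for x y
    by (simp_all add: ring_of_type_algebra_def)
  have uminus: "\<ominus>\<^bsub>?R\<^esub> x = - x" for x
    by (rule R.minus_equality) (simp_all add: ops)
  have inv: "inv\<^bsub>?R\<^esub> x = inverse x" if "x \<noteq> 0" for x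
    by (rule R.comm_inv_char) (simp_all add: ops that)
  have pow: "x [^]\<^bsub>?R\<^esub> (k :: nat) = x ^ k" for x k
    by (induction k) (simp_all add: ops)
  have K: "subfield ?K ?R"
  proof (rule R.subfieldI')
    show "subring ?K ?R"
    proof (rule R.subringI)
      show "\<one>\<^bsub>?R\<^esub> \<in> ?K" by (metis ops(3) rangeI to_ac_1)
    qed (auto simp: ops uminus simp flip: to_ac_minus to_ac_add to_ac_mult)
    show "inv\<^bsub>?R\<^esub> k \<in> ?K" if "k \<in> ?K - {\<zero>\<^bsub>?R\<^esub>}" for k
      using that by (auto simp: inv ops simp flip: to_ac_inverse)
  qed
  have eval: "R.eval (rev cs) x = poly (Poly cs) x" for cs x
    by (induction cs rule: rev_induct) (simp_all add: ops pow Poly_append poly_monom)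
  have alg: "(R.algebraic over ?K) x" for x
  proof -
    obtain q where q: "q \<noteq> 0" "poly (map_poly to_ac q) x = 0" by (rule alg_closure_algebraic)
    define cs where "cs = coeffs (map_poly to_ac q)"
    have q': "map_poly to_ac q \<noteq> 0" using q(1) by (simp add: poly_eq_iff coeff_map_poly)
    show ?thesis
    proof (rule R.algebraicI)
      show ne: "rev cs \<noteq> []" using q' by (simp add: cs_def)
      have "set cs \<subseteq> ?K" by (auto simp: cs_def coeffs_def coeff_map_poly)
      moreover have "hd (rev cs) \<noteq> 0"
        using q' last_coeffs_eq_coeff_degree[OF q'] by (simp add: cs_def hd_rev del: degree_map_poly_to_ac)
      ultimately show "rev cs \<in> carrier (?K[X]\<^bsub>?R\<^esub>)"
        by (simp add: univ_poly_def polynomial_def ops)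
      show "R.eval (rev cs) x = \<zero>\<^bsub>?R\<^esub>" using q(2) by (simp add: eval ops cs_def)
    qed
  qed
  have xs: "set xs \<subseteq> carrier ?R" by (simp add: ops)
  note sub = subfieldE(1)[OF K]
  let ?L = "R.finite_extension ?K xs"
  show ?thesis
  proof (rule that)
    show "finite_extension ?L"
      unfolding Defs.finite_extension_def
      using R.finite_extension_is_subfield[OF K xs alg] R.finite_extension_finite_dimension(1)[OF K xs alg]
        R.finite_extension_incl[OF subringE(1)[OF sub] xs] by blast
    show "set xs \<subseteq> ?L" by (rule R.finite_extension_mem[OF sub xs])
  qed
qed

section \<open>Characterized matrices are correspondent\<close>

lemma padic_val_of_int_prod_list:
  assumes "0 \<notin> set xs"
  shows "padic_val (of_int (prod_list xs) :: 'p :: prime_card padic) =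
    ereal (\<Sum>x\<leftarrow>xs. real (multiplicity (int CARD('p)) x))"
  using assms by (induction xs) (simp_all add: padic_val_mult padic_val_of_int zero_ereal_def)

lemma padic_val_of_int_abs:
  "padic_val (of_int \<bar>m\<bar> :: 'p :: prime_card padic) = padic_val (of_int m :: 'p padic)"
  by (cases "m \<ge> 0") (simp_all add: padic_val_minus)

theorem theorem1:
  fixes A :: "int mat" and n :: nat
  assumes "A \<in> carrier_mat n n"
    and "p_characterized TYPE('p :: prime_card) A"
  shows "p_correspondent TYPE('p) A"
proof -
  note A = assms(1)
  let ?v = "padic_val :: 'p padic \<Rightarrow> ereal"
  obtain s where AD: "unimod_equiv n A (mat_diag n (padded s))"
    and s: "length s \<le> n" "0 \<notin> set s" "sorted_wrt (dvd) s"
    using smith_normal_form_exists[OF A] unfolding padded_def by blast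
  define r where "r = length s"
  have rank: "int_rank A = r" unfolding r_def by (rule int_rank_eq[OF A AD s(2,1)])
  define \<sigma> where "\<sigma> = map (\<lambda>x. real (multiplicity (int CARD('p)) x)) s"
  have len: "length \<sigma> = r" by (simp add: \<sigma>_def r_def)
  have val_s: "?v (of_int (s ! i)) = ereal (\<sigma> ! i)" if "i < r" for i
    using that s(2) by (auto simp: \<sigma>_def r_def in_set_conv_nth intro!: padic_val_of_int)
  have sorted: "sorted \<sigma>"
    unfolding sorted_wrt_iff_nth_less
  proof (intro allI impI)
    fix i j assume ij: "i < j" "j < length \<sigma>"
    then have "s ! i dvd s ! j" "s ! j \<noteq> 0"
      using s(2,3) by (auto simp: sorted_wrt_iff_nth_less len r_def in_set_conv_nth)
    then show "\<sigma> ! i \<le> \<sigma> ! j" using ij by (simp add: \<sigma>_def dvd_imp_multiplicity_le)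
  qed
  have val_\<Delta>: "?v (of_int (determinantal_divisor A i)) = ereal (sum_list (take i \<sigma>))" if "i \<le> r" for i
  proof -
    have "?v (of_int (determinantal_divisor A i)) = ?v (of_int \<bar>determinantal_divisor A i\<bar>)"
      by (simp only: padic_val_of_int_abs)
    also have "\<bar>determinantal_divisor A i\<bar> = \<bar>prod_list (take i s)\<bar>"
      using that by (intro determinantal_divisor_eq[OF A AD s(3,1)]) (simp add: r_def)
    also have "?v (of_int \<dots>) = ereal (\<Sum>x\<leftarrow>take i s. real (multiplicity (int CARD('p)) x))"
      unfolding padic_val_of_int_abs
      by (rule padic_val_of_int_prod_list) (use s(2) in \<open>auto dest: in_set_takeD\<close>)
    finally show ?thesis by (simp add: \<sigma>_def take_map)
  qed
  \<comment> \<open>The factor \<open>h0\<close> carries the nonzero eigenvalues, and its coefficients are those of the characteristic polynomial.\<close>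
  obtain h0 where h0: "char_poly A = monom 1 (n - r) * h0"
    using power_dvd_char_poly[OF A AD s(1)] by (auto simp: r_def)
  have "lead_coeff (char_poly A) = 1" using degree_monic_char_poly[OF A] by simp
  then have monic: "lead_coeff h0 = 1" unfolding h0 lead_coeff_mult by (simp add: degree_monom_eq)
  then have "h0 \<noteq> 0" by auto
  have deg_h0: "degree h0 = r"
  proof -
    have "n = degree (monom 1 (n - r) * h0)" using degree_monic_char_poly[OF A] h0 by simp
    also have "\<dots> = (n - r) + degree h0"
      using \<open>h0 \<noteq> 0\<close> by (simp add: degree_mult_eq degree_monom_eq monom_eq_0_iff)
    finally show ?thesis using s(1) by (simp add: r_def)
  qed
  define h :: "'p padic poly" where "h = map_poly of_int h0"
  have coeff_h: "coeff h i = of_int (coeff h0 i)" for i by (simp add: h_def coeff_map_poly)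
  have deg_h: "degree h = r"
    using monic by (intro antisym degree_le le_degree) (auto simp: coeff_h coeff_eq_0 deg_h0)
  have val_h: "?v (coeff h (r - i)) = ereal (sum_list (take i \<sigma>))" if i: "i \<in> {1..r}" for i
  proof -
    have "coeff (char_poly A) (n - i) = coeff h0 (r - i)"
    proof -
      have "n - r \<le> n - i" "n - i - (n - r) = r - i" using i s(1) by (auto simp: r_def)
      then show ?thesis by (simp add: h0 coeff_monom_mult)
    qed
    moreover have "?v (of_int (coeff (char_poly A) (n - i))) = ?v (of_int (determinantal_divisor A i))"
      using assms(2) A i by (simp add: p_characterized_def rank)
    ultimately show ?thesis using val_\<Delta>[of i] i by (simp add: coeff_h)
  qed
  let ?M = "proots (map_poly to_ac h)"
  have vals: "image_mset padic_val_ext ?M = mset (map ereal \<sigma>)"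
    by (rule newton_slopes_proots[OF sorted]) (use deg_h len monic val_h in \<open>simp_all add: coeff_h deg_h0\<close>)
  have "coeff h 0 \<noteq> 0"
    using val_h[of r] monic by (cases "r = 0") (auto simp: coeff_h deg_h0)
  then have "h \<noteq> 0" by auto
  then have no_zero: "0 \<notin># ?M"
    using \<open>coeff h 0 \<noteq> 0\<close> by (simp add: poly_0_coeff_0 coeff_map_poly)
  obtain ys where ys: "mset ys = ?M" using ex_mset by blast
  obtain K where K: "finite_extension K" "set ys \<subseteq> K"
    by (rule exists_finite_extension)
  have MK: "set_mset ?M \<subseteq> K" using K(2) by (simp flip: ys)
  have "char_poly (map_mat of_int A :: 'p padic alg_closure mat) = map_poly of_int (char_poly A)"
    by (rule of_int_hom.char_poly_hom[OF A])
  also have "\<dots> = monom 1 (n - r) * map_poly to_ac h"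
    by (rule poly_eqI) (simp add: h0 coeff_map_poly coeff_monom_mult coeff_h)
  finally have char_poly: "char_poly (map_mat of_int A :: 'p padic alg_closure mat) = \<dots>" .
  have proots: "proots (char_poly (map_mat of_int A :: 'p padic alg_closure mat))
      = proots (monom 1 (n - r)) + ?M"
    unfolding char_poly using \<open>h \<noteq> 0\<close> by (intro proots_mult) (simp_all add: monom_eq_0_iff)
  have "x = 0" if "x \<in># proots (monom 1 (n - r) :: 'p padic alg_closure poly)" for x
    using that by (auto simp: poly_monom monom_eq_0_iff)
  then have "{# x \<in># proots (monom 1 (n - r)). x \<in> K \<and> x \<noteq> 0 #} = {#}"
    by (auto simp: filter_mset_eq_mempty_iff)
  moreover have "{# x \<in># ?M. x \<in> K \<and> x \<noteq> 0 #} = ?M"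
    using MK no_zero by (subst filter_mset_eq_conv) auto
  ultimately have eigen: "nonzero_eigenvalues_in K (map_mat of_int A) = ?M"
    by (simp add: nonzero_eigenvalues_in_def proots)
  define evs where "evs = sort_key padic_val_ext ys"
  have mset_evs: "mset evs = ?M" by (simp add: evs_def ys)
  have sorted_evs: "sorted (map padic_val_ext evs)" by (simp add: evs_def)
  \<comment> \<open>Both lists are sorted and enumerate the same multiset.\<close>
  have evs_\<sigma>: "map padic_val_ext evs = map ereal \<sigma>"
  proof -
    have "sorted (map ereal \<sigma>)" using sorted by (simp add: sorted_wrt_map)
    moreover have "mset (map padic_val_ext evs) = mset (map ereal \<sigma>)"
      using vals mset_evs by simp
    ultimately show ?thesis using sorted_evs by (metis properties_for_sort)
  qed
  have len_evs: "length evs = r" using arg_cong[OF evs_\<sigma>, of length] len by simp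
  have "invariant_factors A s"
  proof -
    obtain P Q where PQ: "P \<in> carrier_mat n n" "Q \<in> carrier_mat n n" "det P dvd 1" "det Q dvd 1"
      and D: "mat_diag n (padded s) = P * A * Q"
      using AD unfolding unimod_equiv_def by blast
    have inv: "invertible_mat M" if "M \<in> carrier_mat n n" "det M dvd 1" for M :: "int mat"
      using invertible_mat_if_det_unit[OF that] that(1)
      unfolding invertible_mat_def inverts_mat_def by (metis carrier_matD square_mat.simps)
    show ?thesis
      unfolding invariant_factors_def
    proof (intro conjI exI)
      show "length s = int_rank A" by (simp add: rank r_def)
      show "P * A * Q = mat_diag (dim_row A) (\<lambda>i. if i < length s then s ! i else 0)"
        using A by (simp only: D[symmetric] padded_def[abs_def] carrier_matD)
      show "P \<in> carrier_mat (dim_row A) (dim_row A)" "Q \<in> carrier_mat (dim_row A) (dim_row A)"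
        using A PQ by simp_all
      show "invertible_mat P" "invertible_mat Q" by (rule inv; fact PQ)+
    qed (fact s)+
  qed
  moreover have "?v (of_int (s ! i)) = padic_val_ext (evs ! i)" if "i < r" for i
  proof -
    have "padic_val_ext (evs ! i) = map padic_val_ext evs ! i" using that len_evs by simp
    also have "\<dots> = ereal (\<sigma> ! i)" using that len by (simp add: evs_\<sigma>)
    finally show ?thesis using val_s[OF that] by simp
  qed
  ultimately show ?thesis
    unfolding p_correspondent_def using K(1) mset_evs eigen len_evs sorted_evs rank
    by (intro exI[of _ K] exI[of _ evs] exI[of _ s]) auto
qed

end
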